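(* For any constant $0<\varepsilon<2/3$, any randomized algorithm that with high probability estimates the metric Steiner Tree cost to within a factor of $(5/3-\varepsilon)$ performs $\Omega(n^2/4^{1/\varepsilon})$ queries in the worst case, and this holds even when the number of terminals $k$ is a constant (depending only on $\varepsilon$).
   Context: An instance of the metric Steiner Tree problem is a triple $(V,T,w)$ where $V$ is a set of $n$ points, $T\subseteq V$ is a set of $k$ terminals, and $w$ is a metric on $V$. A Steiner tree is a tree whose vertices are points of $V$ and which contains all points of $T$; its cost is the sum of $w(u,v)$ over its edges $(u,v)$. ${\mathsf{ST}}(V,T,w)$ denotes the minimum cost of a Steiner tree. An algorithm knows $V$ and $T$ but can access $w$ only through queries: a query specifies a pair $u,v\in V$ and returns $w(u,v)$. The query complexity is the number of queries performed. An algorithm estimates the Steiner Tree cost to within a factor $\alpha\ge 1$ if it outputs a number $X$ with ${\mathsf{ST}}(V,T,w)\le X\le \alpha\cdot{\mathsf{ST}}(V,T,w)$. *)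

theory Defs
  imports "HOL-Probability.Probability"
begin

section \<open>The metric Steiner Tree problem\<close>

text \<open>Points are labelled by natural numbers. A graph is a vertex set \<open>S\<close> together with a set
  \<open>E\<close> of two-element subsets of \<open>S\<close>. In \<open>is_tree\<close>, the list in the last conjunct enumerates the
  vertices of a simple cycle without repeating its starting point.\<close>

definition is_tree :: "nat set \<Rightarrow> nat set set \<Rightarrow> bool" where
  "is_tree S E \<longleftrightarrow>
     S \<noteq> {} \<and>
     E \<subseteq> {{u, v} | u v. u \<in> S \<and> v \<in> S \<and> u \<noteq> v} \<and>
     (\<forall>u\<in>S. \<forall>v\<in>S. (\<lambda>x y. {x, y} \<in> E)\<^sup>*\<^sup>* u v) \<and>
     (\<nexists>p. 3 \<le> length p \<and> distinct p \<and> successively (\<lambda>x y. {x, y} \<in> E) p \<and> {last p, hd p} \<in> E)"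

definition steiner_tree :: "nat set \<Rightarrow> nat set \<Rightarrow> nat set \<Rightarrow> nat set set \<Rightarrow> bool" where
  "steiner_tree V T S E \<longleftrightarrow> T \<subseteq> S \<and> S \<subseteq> V \<and> is_tree S E"

text \<open>The edge \<open>{u, v}\<close> is weighted by \<open>w (Min {u, v}) (Max {u, v})\<close>, which is \<open>w u v\<close> since the
  metric \<open>w\<close> is symmetric.\<close>

definition tree_cost :: "(nat \<Rightarrow> nat \<Rightarrow> real) \<Rightarrow> nat set set \<Rightarrow> real" where
  "tree_cost w E = (\<Sum>e\<in>E. w (Min e) (Max e))"

definition ST :: "nat set \<Rightarrow> nat set \<Rightarrow> (nat \<Rightarrow> nat \<Rightarrow> real) \<Rightarrow> real" where
  "ST V T w = Min {tree_cost w E | S E. steiner_tree V T S E}"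

definition st_instance :: "nat \<Rightarrow> nat \<Rightarrow> nat set \<Rightarrow> nat set \<Rightarrow> (nat \<Rightarrow> nat \<Rightarrow> real) \<Rightarrow> bool" where
  "st_instance n k V T w \<longleftrightarrow>
     finite V \<and> card V = n \<and> T \<subseteq> V \<and> card T = k \<and> Metric_space V w"


section \<open>Query algorithms\<close>

text \<open>A deterministic query algorithm is an adaptive decision tree: it either outputs a number, or
  queries a pair of points and continues depending on the returned distance.\<close>

datatype query_alg = Output real | Query nat nat "real \<Rightarrow> query_alg"

primrec queries_within :: "nat set \<Rightarrow> query_alg \<Rightarrow> bool" where
  "queries_within V (Output x) \<longleftrightarrow> True"
| "queries_within V (Query u v f) \<longleftrightarrow> u \<in> V \<and> v \<in> V \<and> (\<forall>r. queries_within V (f r))"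

primrec alg_output :: "query_alg \<Rightarrow> (nat \<Rightarrow> nat \<Rightarrow> real) \<Rightarrow> real" where
  "alg_output (Output x) w = x"
| "alg_output (Query u v f) w = alg_output (f (w u v)) w"

primrec num_queries :: "query_alg \<Rightarrow> (nat \<Rightarrow> nat \<Rightarrow> real) \<Rightarrow> nat" where
  "num_queries (Output x) w = 0"
| "num_queries (Query u v f) w = Suc (num_queries (f (w u v)) w)"

text \<open>A randomized algorithm is a probability distribution over deterministic ones, such that on
  every metric its output is a random variable. Arbitrary probability spaces are allowed, so
  every way of supplying random bits is covered.\<close>

definition randomized_alg :: "nat set \<Rightarrow> query_alg measure \<Rightarrow> bool" where
  "randomized_alg V M \<longleftrightarrow>
     prob_space M \<and>
     (\<forall>t\<in>space M. queries_within V t) \<and>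
     (\<forall>w. Metric_space V w \<longrightarrow> (\<lambda>t. alg_output t w) \<in> borel_measurable M)"

text \<open>Below, the randomized algorithm \<open>A V T\<close> may depend on \<open>V\<close> and \<open>T\<close>, which are known, but not
  on \<open>w\<close>, which is accessible only through queries.\<close>

definition estimates_ST ::
  "(nat set \<Rightarrow> nat set \<Rightarrow> query_alg measure) \<Rightarrow> nat \<Rightarrow> nat \<Rightarrow> real \<Rightarrow> real \<Rightarrow> bool" where
  "estimates_ST A n k \<alpha> p \<longleftrightarrow>
     (\<forall>V T w. st_instance n k V T w \<longrightarrow>
        randomized_alg V (A V T) \<and>
        measure (A V T)
          {t \<in> space (A V T). ST V T w \<le> alg_output t w \<and> alg_output t w \<le> \<alpha> * ST V T w} \<ge> p)"

text \<open>The least \<open>q\<close>, possibly infinite, such that on every instance with \<open>n\<close> points and \<open>k\<close>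
  terminals at most \<open>q\<close> queries are performed, whatever the random choices are. Null sets of random
  choices are disregarded.\<close>

definition worst_case_queries ::
  "(nat set \<Rightarrow> nat set \<Rightarrow> query_alg measure) \<Rightarrow> nat \<Rightarrow> nat \<Rightarrow> enat" where
  "worst_case_queries A n k =
     Inf {q. \<forall>V T w. st_instance n k V T w \<longrightarrow> (AE t in A V T. enat (num_queries t w) \<le> q)}"

end

(* Root a complete binary tree of depth d, with the terminals as leaves, and let D h = lam^h be the
   distance from a node of height h > 0 to the leaves below it, where lam = 2 - 6/d. Every inner
   node is represented by about n / 2^d interchangeable Steiner points. All distances to terminals
   are the tree distances, but the distance of two Steiner points is by default that of the best
   path through a terminal. In a planted instance one secret point per inner node is chosen, and
   chosen points are at tree distance from each other; then the tree itself is a Steiner tree of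
   cost Y, say. A query hits a pair of chosen points with probability at most (2^d / n)^2, so fewer
   than about n^2 / 4^d queries cannot tell the planted instances from the unplanted one.

   Without planted points, every edge splits at no cost into edges between a Steiner point and a
   terminal, so a Steiner tree is a union of stars. A star whose terminals lie in m_j different
   classes of height j costs at least beta * sum_j (D (j + 1) - D j) * (m_j - 1), with
   beta = 2 - 1 / (1 + lam) close to 5/3. Since the stars have to connect the 2^(d - j) classes of
   every height j, the cost is at least beta * (Y - D d), which exceeds (5/3 - 1/d) * Y. The choice
   of lam slightly below 2 makes Y about 6 * d * D d and so keeps the loss below 1/d; with lam = 2
   it would be about 5 / (3 * d). *)

theory Submission
  imports Defs
begin

section \<open>Indistinguishable instances\<close>

primrec queried :: "query_alg \<Rightarrow> (nat \<Rightarrow> nat \<Rightarrow> real) \<Rightarrow> (nat \<times> nat) set" where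
  "queried (Output x) w = {}"
| "queried (Query u v f) w = insert (u, v) (queried (f (w u v)) w)"

lemma finite_queried: "finite (queried t w)"
  by (induction t) auto

lemma card_queried_le: "card (queried t w) \<le> num_queries t w"
proof (induction t)
  case (Query u v f)
  have "card (queried (Query u v f) w) \<le> Suc (card (queried (f (w u v)) w))"
    by (simp add: card_insert_if finite_queried)
  also have "\<dots> \<le> num_queries (Query u v f) w"
    using Query[of "f (w u v)"] by simp
  finally show ?case .
qed simp

lemma alg_output_eq_if_agree:
  "(\<And>u v. (u, v) \<in> queried t w \<Longrightarrow> w' u v = w u v) \<Longrightarrow> alg_output t w' = alg_output t w"
  by (induction t) auto

text \<open>A run correct on both \<open>w0\<close> and \<open>w i\<close> has to query a pair where
  they differ, because the two output ranges are disjoint. For each \<open>i\<close> this has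
  probability at least \<open>2 * p - 1\<close>, while a run with at most \<open>q\<close> queries
  on \<open>w0\<close> can expose at most \<open>q * card I / G\<close> indices. Averaging over the
  runs compares the two.\<close>

lemma expected_queries_lower_bound:
  fixes w :: "'i \<Rightarrow> nat \<Rightarrow> nat \<Rightarrow> real" and w0 :: "nat \<Rightarrow> nat \<Rightarrow> real" and G p :: real and q :: nat
  assumes "prob_space M" and I: "finite I" "I \<noteq> {}"
    and meas0: "(\<lambda>t. alg_output t w0) \<in> borel_measurable M"
    and meas: "\<And>i. i \<in> I \<Longrightarrow> (\<lambda>t. alg_output t (w i)) \<in> borel_measurable M"
    and p0: "p \<le> measure M {t \<in> space M. lo \<le> alg_output t w0 \<and> alg_output t w0 \<le> hi}"
    and p1: "\<And>i. i \<in> I \<Longrightarrow>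
      p \<le> measure M {t \<in> space M. lo' i \<le> alg_output t (w i) \<and> alg_output t (w i) \<le> hi' i}"
    and separated: "\<And>i. i \<in> I \<Longrightarrow> hi' i < lo"
    and bounded: "AE t in M. num_queries t w0 \<le> q"
    and G: "0 < G"
    and rare: "\<And>a b. G * card {i \<in> I. w i a b \<noteq> w0 a b} \<le> card I"
  shows "(2 * p - 1) * G \<le> q"
proof -
  interpret prob_space M by fact
  define E0 where "E0 = {t \<in> space M. lo \<le> alg_output t w0 \<and> alg_output t w0 \<le> hi}"
  define E where "E i = {t \<in> space M. lo' i \<le> alg_output t (w i) \<and> alg_output t (w i) \<le> hi' i}" for i
  note meas0[measurable] meas[measurable]
  have E0: "E0 \<in> events" unfolding E0_def by measurable
  have E: "E i \<in> events" if "i \<in> I" for i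
    unfolding E_def using meas[OF that] by measurable
  have both: "2 * p - 1 \<le> prob (E0 \<inter> E i)" if "i \<in> I" for i
  proof -
    have "prob (E0 \<union> E i) = prob E0 + prob (E i) - prob (E0 \<inter> E i)"
      using E0 E[OF that] by (simp add: measure_Un3 fmeasurable_eq_sets)
    moreover have "prob (E0 \<union> E i) \<le> 1" by simp
    ultimately show ?thesis using p0 p1[OF that] unfolding E0_def E_def by linarith
  qed
  define X where "X t = (\<Sum>i\<in>I. indicator (E0 \<inter> E i) t :: real)" for t
  have intX: "integrable M X"
    unfolding X_def using E0 E by (intro Bochner_Integration.integrable_sum) (auto simp: less_top[symmetric])
  have "card I * (2 * p - 1) \<le> (\<Sum>i\<in>I. prob (E0 \<inter> E i))"
    using sum_mono[of I "\<lambda>_. 2 * p - 1", OF both] by simp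
  also have "\<dots> = expectation X"
    unfolding X_def using E0 E
    by (subst Bochner_Integration.integral_sum) (auto simp: less_top[symmetric] intro!: sum.cong)
  also have "\<dots> \<le> expectation (\<lambda>_. q * card I / G)"
  proof (rule integral_mono_AE[OF intX])
    show "AE t in M. X t \<le> q * card I / G"
      using bounded
    proof eventually_elim
      case (elim t)
      have sub: "{i \<in> I. t \<in> E0 \<inter> E i} \<subseteq> (\<Union>(a, b)\<in>queried t w0. {i \<in> I. w i a b \<noteq> w0 a b})"
      proof
        fix i assume "i \<in> {i \<in> I. t \<in> E0 \<inter> E i}"
        then have i: "i \<in> I" and "alg_output t (w i) \<noteq> alg_output t w0"
          using separated[of i] by (auto simp: E0_def E_def)
        then show "i \<in> (\<Union>(a, b)\<in>queried t w0. {i \<in> I. w i a b \<noteq> w0 a b})"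
          using alg_output_eq_if_agree[where t = t and w = w0 and w' = "w i"] by auto
      qed
      have "X t = card {i \<in> I. t \<in> E0 \<inter> E i}"
        using I by (simp add: X_def indicator_def sum.If_cases Int_def)
      also have "\<dots> \<le> card (\<Union>(a, b)\<in>queried t w0. {i \<in> I. w i a b \<noteq> w0 a b})"
        using sub I by (intro of_nat_mono card_mono) (auto simp: finite_queried)
      also have "\<dots> \<le> (\<Sum>(a, b)\<in>queried t w0. card {i \<in> I. w i a b \<noteq> w0 a b})"
        using card_UN_le[of "queried t w0" "\<lambda>(a, b). {i \<in> I. w i a b \<noteq> w0 a b}"]
        by (simp add: case_prod_unfold finite_queried flip: of_nat_sum)
      also have "\<dots> \<le> (\<Sum>(a, b)\<in>queried t w0. card I / G)"
        unfolding case_prod_unfold of_nat_sum using G rare by (intro sum_mono) (simp add: pos_le_divide_eq mult.commute)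
      also have "\<dots> = card (queried t w0) * (card I / G)" by (simp add: case_prod_unfold)
      also have "\<dots> \<le> q * (card I / G)"
        using G elim card_queried_le[of t w0] by (intro mult_right_mono) auto
      finally show ?case by simp
    qed
  qed simp
  also have "\<dots> = q * card I / G" by (simp add: prob_space)
  finally have "card I * ((2 * p - 1) * G) \<le> card I * real q"
    using G by (simp add: field_simps)
  then show ?thesis using I by (simp add: card_gt_0_iff)
qed

section \<open>Connected hypergraphs, and trees given by a parent map\<close>

text \<open>Grow \<open>X\<close> by a hyperedge that sticks out of it: sharing a point with
  \<open>X\<close>, it adds at most \<open>card (K a) - 1\<close> new ones. Once absorbed it cannot
  stick out again, so it is dropped from \<open>A\<close>.\<close>

lemma card_le_sum_connecting_hyperedges:
  fixes K :: "'a \<Rightarrow> 'b set"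
  assumes "finite A" and "finite X" and "\<And>a. a \<in> A \<Longrightarrow> finite (K a)"
    and "\<And>Z. X \<subseteq> Z \<Longrightarrow> \<not> Q \<subseteq> Z \<Longrightarrow> \<exists>a\<in>A. K a \<inter> Z \<noteq> {} \<and> \<not> K a \<subseteq> Z"
  shows "card Q \<le> card X + (\<Sum>a\<in>A. card (K a) - 1)"
  using assms
proof (induction "card A" arbitrary: A X)
  case 0
  then have "Q \<subseteq> X" by auto
  then show ?case using 0 card_mono[of X Q] by simp
next
  case (Suc m)
  show ?case
  proof (cases "Q \<subseteq> X")
    case True
    then show ?thesis using Suc.prems card_mono[of X Q] by simp
  next
    case False
    then obtain a where a: "a \<in> A" "K a \<inter> X \<noteq> {}" "\<not> K a \<subseteq> X"
      using Suc.prems(4)[of X] by blast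
    have fK: "finite (K a)" using Suc.prems a by blast
    have "card Q \<le> card (X \<union> K a) + (\<Sum>b\<in>A - {a}. card (K b) - 1)"
    proof (rule Suc.hyps(1))
      show "m = card (A - {a})" using Suc.hyps Suc.prems a by simp
      fix Z assume Z: "X \<union> K a \<subseteq> Z" "\<not> Q \<subseteq> Z"
      then show "\<exists>b\<in>A - {a}. K b \<inter> Z \<noteq> {} \<and> \<not> K b \<subseteq> Z"
        using Suc.prems(4)[of Z] by blast
    qed (use Suc.prems fK in auto)
    moreover have "card (X \<union> K a) + 1 \<le> card X + card (K a)"
      using card_Un_Int[OF \<open>finite X\<close> fK] a fK card_gt_0_iff[of "X \<inter> K a"] by (auto simp: Int_commute)
    moreover have "card (K a) > 0" using a fK by (auto simp: card_gt_0_iff)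
    moreover have "(\<Sum>b\<in>A. card (K b) - 1) = (card (K a) - 1) + (\<Sum>b\<in>A - {a}. card (K b) - 1)"
      using Suc.prems a by (simp add: sum.remove)
    ultimately show ?thesis by linarith
  qed
qed

lemma cycle_two_neighbours:
  assumes len: "3 \<le> length p" and "distinct p" and succ: "successively R p" and close: "R (last p) (hd p)"
    and sym: "\<And>x y. R x y \<Longrightarrow> R y x" and x: "x \<in> set p"
  shows "\<exists>y\<in>set p. \<exists>z\<in>set p. y \<noteq> z \<and> R x y \<and> R x z"
proof -
  have R: "R (p ! i) (p ! Suc i)" if "Suc i < length p" for i
    using succ that by (simp add: successively_conv_nth)
  have close': "R (p ! (length p - 1)) (p ! 0)"
  proof -
    have "p \<noteq> []" using len by auto
    then show ?thesis using close by (simp add: last_conv_nth hd_conv_nth)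
  qed
  have neq: "p ! i \<noteq> p ! j" if "i < length p" "j < length p" "i \<noteq> j" for i j
    using that \<open>distinct p\<close> by (simp add: nth_eq_iff_index_eq)
  obtain i where i: "i < length p" "x = p ! i" using x by (metis in_set_conv_nth)
  consider "i = 0" | "i = length p - 1" "i \<noteq> 0" | "0 < i" "Suc i < length p" using i by linarith
  then show ?thesis
  proof cases
    case 1
    then show ?thesis using R[of 0] sym[OF close'] neq[of 1 "length p - 1"] len i
      by (intro bexI[of _ "p ! 1"] bexI[of _ "p ! (length p - 1)"]) auto
  next
    case 2
    have "Suc (length p - 2) = length p - 1" using len by simp
    then have "R x (p ! (length p - 2))" using sym[OF R[of "length p - 2"]] 2 len i by auto
    moreover have "p ! 0 \<noteq> p ! (length p - 2)" using neq[of 0 "length p - 2"] len by (cases "p = []") auto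
    moreover have "p ! 0 \<in> set p" "p ! (length p - 2) \<in> set p" using len by (auto intro!: nth_mem)
    moreover have "R x (p ! 0)" using close' i 2 by simp
    ultimately show ?thesis by blast
  next
    case 3
    then show ?thesis using sym[OF R[of "i - 1"]] R[of i] neq[of "i - 1" "Suc i"] i
      by (intro bexI[of _ "p ! (i - 1)"] bexI[of _ "p ! Suc i"]) auto
  qed
qed

text \<open>Ranks increase along \<open>par\<close> and are bounded, so every vertex climbs to
  \<open>top_node\<close>. A vertex of least rank on a cycle can only have its parent as a neighbour
  there, but a cycle supplies two.\<close>

lemma is_treeI_parent:
  fixes r par :: "nat \<Rightarrow> nat"
  assumes "top_node \<in> S"
    and parent: "\<And>x. x \<in> S \<Longrightarrow> x \<noteq> top_node \<Longrightarrow> par x \<in> S \<and> r x < r (par x)"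
    and bounded: "\<And>x. x \<in> S \<Longrightarrow> r x \<le> b"
  shows "is_tree S ((\<lambda>x. {x, par x}) ` (S - {top_node}))"
proof -
  let ?E = "(\<lambda>x. {x, par x}) ` (S - {top_node})"
  let ?R = "\<lambda>x y. {x, y} \<in> ?E"
  have sym: "?R x y \<Longrightarrow> ?R y x" for x y by (simp add: insert_commute)
  have up: "?R\<^sup>*\<^sup>* x top_node" if "x \<in> S" for x
    using that
  proof (induction "b - r x" arbitrary: x rule: less_induct)
    case less
    show ?case
    proof (cases "x = top_node")
      case False
      then have par: "par x \<in> S" "r x < r (par x)" using parent less by auto
      have "?R x (par x)" using less.prems False by auto
      moreover have "?R\<^sup>*\<^sup>* (par x) top_node"
        using less.hyps[of "par x"] bounded[of "par x"] par by linarith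
      ultimately show ?thesis by (rule converse_rtranclp_into_rtranclp[of ?R])
    qed simp
  qed
  have conn: "?R\<^sup>*\<^sup>* x y" if "x \<in> S" "y \<in> S" for x y
  proof -
    have "symp ?R" by (rule sympI) (rule sym)
    then have "?R\<^sup>*\<^sup>* top_node y" by (rule sympD[OF symp_rtranclp up[OF \<open>y \<in> S\<close>]])
    then show ?thesis using up[OF \<open>x \<in> S\<close>] by (rule rtranclp_trans[rotated])
  qed
  have no_cycle: False if p: "3 \<le> length p" "distinct p" "successively ?R p" "?R (last p) (hd p)" for p
  proof -
    have "set p \<noteq> {}" using p by auto
    then obtain x where x: "x \<in> set p" "\<And>y. y \<in> set p \<Longrightarrow> r x \<le> r y"
      using that[OF arg_min_if_finite(1)[of "set p" r]] arg_min_least[of "set p" _ r] by simp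
    have "y = par x" if "y \<in> set p" "?R x y" for y
    proof -
      obtain z where z: "z \<in> S - {top_node}" "{x, y} = {z, par z}" using \<open>?R x y\<close> by auto
      then have "r z < r (par z)" using parent by auto
      then show ?thesis using z x(2)[OF that(1)] by (auto simp: doubleton_eq_iff)
    qed
    moreover have "\<exists>y\<in>set p. \<exists>z\<in>set p. y \<noteq> z \<and> ?R x y \<and> ?R x z"
      by (rule cycle_two_neighbours[OF p _ x(1)]) (rule sym)
    ultimately show False by metis
  qed
  have "?E \<subseteq> {{u, v} | u v. u \<in> S \<and> v \<in> S \<and> u \<noteq> v}"
  proof
    fix e assume "e \<in> ?E"
    then obtain x where x: "x \<in> S" "x \<noteq> top_node" "e = {x, par x}" by auto
    have "par x \<in> S" "x \<noteq> par x" using parent[OF x(1,2)] by (simp, metis less_irrefl)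
    with x show "e \<in> {{u, v} | u v. u \<in> S \<and> v \<in> S \<and> u \<noteq> v}"
      by (intro CollectI exI[of _ x] exI[of _ "par x"]) simp
  qed
  moreover have "S \<noteq> {}" using \<open>top_node \<in> S\<close> by auto
  moreover have "\<nexists>p. 3 \<le> length p \<and> distinct p \<and> successively ?R p \<and> ?R (last p) (hd p)"
    using no_cycle by (intro notI, elim exE conjE)
  ultimately show ?thesis
    unfolding is_tree_def by (intro conjI ballI conn)
qed

section \<open>The tree metric and its planted variants\<close>

text \<open>The point \<open>v\<close> represents the tree node of height \<open>ht v\<close> whose leaves \<open>t\<close> are those with
  \<open>t div 2 ^ ht v = ps v div 2 ^ ht v\<close>; thus \<open>ps v div 2 ^ j\<close> is its ancestor at height \<open>j\<close>.\<close>

locale tree_metric =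
  fixes d :: nat and lam :: real and ht ps :: "nat \<Rightarrow> nat" and V :: "nat set"
  assumes lam: "1 < lam" "lam + 1 \<le> lam\<^sup>2"
    and ht_le: "ht v \<le> d" and ps_less: "ps v < 2 ^ d"
    and ht_eq_0_iff: "ht v = 0 \<longleftrightarrow> v < 2 ^ d" and ps_leaf: "v < 2 ^ d \<Longrightarrow> ps v = v"
    and finite_V: "finite V"
    and inhabited: "\<lbrakk>0 < a; a \<le> d; i < 2 ^ (d - a)\<rbrakk> \<Longrightarrow> \<exists>v\<in>V. ht v = a \<and> ps v div 2 ^ a = i"
begin

text \<open>The value at 0 is set apart, as a leaf has distance 0 to itself. There the recursion
  \<open>D_Suc\<close> fails and only \<open>D_Suc_ge\<close> is left.\<close>

definition D :: "nat \<Rightarrow> real" where "D h = (if h = 0 then 0 else lam ^ h)"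

text \<open>The height of the lowest common ancestor; for two points of the same node it is the
  height of that node.\<close>

definition meet :: "nat \<Rightarrow> nat \<Rightarrow> nat" where
  "meet u v = (LEAST j. ht u \<le> j \<and> ht v \<le> j \<and> ps u div 2 ^ j = ps v div 2 ^ j)"

text \<open>The tree distance is \<open>2 * D (meet u v) - D (ht u) - D (ht v)\<close>. The shortest detour through a
  leaf goes below the lower of the two points, which replaces the last two terms by
  \<open>\<bar>D (ht u) - D (ht v)\<bar>\<close>. For a leaf the two expressions agree.\<close>

definition w :: "nat set \<Rightarrow> nat \<Rightarrow> nat \<Rightarrow> real" where
  "w P u v = (if u = v then 0 else 2 * D (meet u v) -
     (if u \<in> P \<and> v \<in> P then D (ht u) + D (ht v) else \<bar>D (ht u) - D (ht v)\<bar>))"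

section \<open>Heights, common ancestors and the metric axioms\<close>

lemma D_0 [simp]: "D 0 = 0" and D_pos: "0 < h \<Longrightarrow> 0 < D h"
  using lam by (auto simp: D_def)

lemma D_strict_mono: "h < h' \<Longrightarrow> D h < D h'"
  using lam by (auto simp: D_def)

lemma D_mono: "h \<le> h' \<Longrightarrow> D h \<le> D h'"
  using D_strict_mono[of h h'] by (cases "h = h'") auto

lemma D_nonneg: "0 \<le> D h"
  using D_mono[of 0 h] by simp

lemma D_Suc: "0 < h \<Longrightarrow> D (Suc h) = lam * D h"
  by (simp add: D_def)

lemma D_Suc_ge: "lam * D h \<le> D (Suc h)"
  using lam by (simp add: D_def)

lemma class_eq_mono: "\<lbrakk>x div 2 ^ j = y div 2 ^ j; j \<le> j'\<rbrakk> \<Longrightarrow> x div 2 ^ j' = y div (2 ^ j' :: nat)"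
  by (metis div_mult2_eq le_Suc_ex power_add)

lemma meet_exists: "ht u \<le> d \<and> ht v \<le> d \<and> ps u div 2 ^ d = ps v div 2 ^ d"
  using ht_le ps_less by simp

lemma meet_ge: "ht u \<le> meet u v \<and> ht v \<le> meet u v"
  and meet_class: "ps u div 2 ^ meet u v = ps v div 2 ^ meet u v"
  unfolding meet_def using LeastI[of "\<lambda>j. ht u \<le> j \<and> ht v \<le> j \<and> ps u div 2 ^ j = ps v div 2 ^ j", OF meet_exists] by auto

lemma meet_le: "\<lbrakk>ht u \<le> j; ht v \<le> j; ps u div 2 ^ j = ps v div 2 ^ j\<rbrakk> \<Longrightarrow> meet u v \<le> j"
  unfolding meet_def by (rule Least_le) simp

lemma meet_le_d: "meet u v \<le> d"
  using meet_exists by (intro meet_le) auto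

lemma meet_commute: "meet u v = meet v u"
  unfolding meet_def by (rule arg_cong[where f = Least]) auto

lemma meet_ultra: "meet x z \<le> max (meet x y) (meet y z)"
proof (rule meet_le)
  let ?j = "max (meet x y) (meet y z)"
  show "ht x \<le> ?j" "ht z \<le> ?j" using meet_ge[of x y] meet_ge[of y z] by auto
  show "ps x div 2 ^ ?j = ps z div 2 ^ ?j"
    using class_eq_mono[OF meet_class[of x y], of ?j] class_eq_mono[OF meet_class[of y z], of ?j] by simp
qed

lemma L_ultra: "D (meet x z) \<le> D (meet x y) \<or> D (meet x z) \<le> D (meet y z)"
  using meet_ultra[of x z y] D_mono by (auto simp: max_def split: if_splits)

lemma f_le_L: "D (ht x) \<le> D (meet x y) \<and> D (ht y) \<le> D (meet x y)"
  using meet_ge D_mono by auto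

lemma w_commute: "w P u v = w P v u"
  by (auto simp: w_def meet_commute)

lemma w_nonneg: "0 \<le> w P u v"
  using f_le_L[of u v] D_nonneg[of "ht u"] D_nonneg[of "ht v"] unfolding w_def by (auto simp: abs_if)

text \<open>Given \<open>L_ultra\<close> and \<open>f_le_L\<close>, each of the eight cases of
  membership in \<open>P\<close> is linear arithmetic. Coinciding points are split off, since the
  formula in \<open>w\<close> need not give 0 on the diagonal.\<close>

lemma w_triangle: "w P x z \<le> w P x y + w P y z"
proof (cases "x = y \<or> y = z \<or> x = z")
  case True
  moreover have "w P u u = 0" for u by (simp add: w_def)
  ultimately show ?thesis using w_nonneg[of P x y] w_nonneg[of P y z] by auto
next
  case False
  note L = f_le_L[of x y] f_le_L[of y z] f_le_L[of x z]
    D_nonneg[of "ht x"] D_nonneg[of "ht y"] D_nonneg[of "ht z"]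
  show ?thesis
    using L L_ultra[of x z y] False unfolding w_def abs_if
    by (cases "x \<in> P"; cases "y \<in> P"; cases "z \<in> P") (auto split: if_splits)
qed

text \<open>Two chosen points of one node would be at tree distance 0, so a metric permits at most
  one per node.\<close>

definition transversal :: "nat set \<Rightarrow> bool" where
  "transversal P \<longleftrightarrow> (\<forall>u\<in>P. \<forall>v\<in>P. ht u = ht v \<longrightarrow> ps u div 2 ^ ht u = ps v div 2 ^ ht u \<longrightarrow> u = v)"

lemma w_pos:
  assumes "transversal P" "u \<noteq> v"
  shows "0 < w P u v"
proof (cases "u \<in> P \<and> v \<in> P")
  case True
  have "ht u < meet u v \<or> ht v < meet u v"
  proof (rule ccontr)
    assume "\<not> ?thesis"
    then have "ht u = meet u v" "ht v = meet u v" using meet_ge[of u v] by auto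
    then show False using True assms meet_class[of u v] unfolding transversal_def by metis
  qed
  then have "D (ht u) < D (meet u v) \<or> D (ht v) < D (meet u v)" using D_strict_mono by blast
  then show ?thesis using True assms f_le_L[of u v] by (auto simp: w_def)
next
  case False
  have "0 < meet u v"
  proof (rule ccontr)
    assume "\<not> ?thesis"
    then have "ht u = 0" "ht v = 0" "ps u = ps v" using meet_ge[of u v] meet_class[of u v] by auto
    then show False using assms ht_eq_0_iff ps_leaf by metis
  qed
  then show ?thesis
    using False assms D_pos[of "meet u v"] f_le_L[of u v] D_nonneg[of "ht u"] D_nonneg[of "ht v"]
    by (auto simp: w_def abs_if)
qed

lemma Metric_space_w: "transversal P \<Longrightarrow> Metric_space X (w P)"
proof
  show "w P x y = 0 \<longleftrightarrow> x = y" if "transversal P" for x y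
  proof -
    have "w P x x = 0" by (simp add: w_def)
    then show ?thesis using w_pos[OF that, of x y] by (cases "x = y") auto
  qed
qed (rule w_nonneg w_commute w_triangle)+

lemma Min_Max_w: "w P (Min {x, y}) (Max {x, y}) = w P x y"
  using w_commute[of P x y] by (cases "x \<le> y") (auto simp: min_def max_def)

end

section \<open>Stars in the unplanted metric\<close>

context tree_metric
begin

text \<open>\<open>\<sigma>\<close> solves \<open>\<sigma> * lam + \<sigma> = 1\<close>, tuned so
  that joining one terminal of the sibling subtree to a star is estimated without loss.
  \<open>\<delta> j\<close> is the tree length of an edge between heights \<open>j\<close> and
  \<open>j + 1\<close>.\<close>

definition \<sigma> :: real where "\<sigma> = 1 / (1 + lam)"
definition \<beta> :: real where "\<beta> = 2 - \<sigma>"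
definition \<delta> :: "nat \<Rightarrow> real" where "\<delta> j = D (Suc j) - D j"

text \<open>A minimum spanning tree of \<open>K\<close> for the ultrametric \<open>D (meet s t)\<close> has this
  cost, when \<open>K\<close> lies below one node of height \<open>b\<close>.\<close>

definition spread :: "nat \<Rightarrow> nat set \<Rightarrow> real" where
  "spread b K = (\<Sum>j<b. \<delta> j * (real (card ((\<lambda>t. t div 2 ^ j) ` K)) - 1))"

lemma \<delta>_pos: "0 < \<delta> j"
  using D_strict_mono[of j "Suc j"] by (simp add: \<delta>_def)

lemma sum_\<delta>: "(\<Sum>j<b. \<delta> j) = D b"
  unfolding \<delta>_def by (simp add: sum_lessThan_telescope)

lemma \<sigma>_pos: "0 < \<sigma>" and \<sigma>_less: "\<sigma> < 1" and \<sigma>_lam: "\<sigma> * lam + \<sigma> = 1"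
  using lam by (auto simp: \<sigma>_def field_simps)

text \<open>Like \<open>\<beta>_le_lam\<close>, a form of \<open>lam + 1 \<le> lam\<^sup>2\<close>:
  the base is at least the golden ratio.\<close>

lemma \<sigma>_lam2: "1 \<le> \<sigma> * lam\<^sup>2"
  using lam by (simp add: \<sigma>_def field_simps)

lemma \<beta>_le_lam: "\<beta> \<le> lam"
proof -
  have "\<beta> * (1 + lam) = 1 + 2 * lam" using lam by (simp add: \<beta>_def \<sigma>_def field_simps)
  also have "\<dots> \<le> lam * (1 + lam)" using lam by (simp add: algebra_simps power2_eq_square)
  finally show ?thesis using lam by simp
qed

lemma \<beta>_gt_1: "1 < \<beta>" and \<beta>_less_2: "\<beta> < 2"
  using \<sigma>_pos \<sigma>_less by (auto simp: \<beta>_def)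

lemma \<beta>_D_le: "\<beta> * D b \<le> D (Suc b)"
  using mult_right_mono[OF \<beta>_le_lam D_nonneg[of b]] D_Suc_ge[of b] by linarith

lemma spread_single: "card K = 1 \<Longrightarrow> spread b K = 0"
  by (auto simp: spread_def card_1_singleton_iff)

lemma card_image_class:
  assumes "K \<noteq> {}" "\<And>t. t \<in> K \<Longrightarrow> t div 2 ^ b = (c :: nat)"
  shows "card ((\<lambda>t. t div 2 ^ b) ` K) = 1"
proof -
  have "(\<lambda>t. t div 2 ^ b) ` K = {c}" using assms by auto
  then show ?thesis by simp
qed

lemma spread_Suc_one_class:
  assumes "K \<noteq> {}" "\<And>t. t \<in> K \<Longrightarrow> t div 2 ^ b = c"
  shows "spread (Suc b) K = spread b K"
  using card_image_class[OF assms] by (simp add: spread_def)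

text \<open>No class of height at most \<open>b\<close> meets both sets, so class counts add.
  Subtracting 1 once instead of twice leaves an extra \<open>\<delta> j\<close> for every
  \<open>j \<le> b\<close>, in total \<open>D (Suc b)\<close>.\<close>

lemma spread_Suc_two_classes:
  assumes fin: "finite K" "finite K'" and ne: "K \<noteq> {}" "K' \<noteq> {}" and "c \<noteq> c'"
    and c: "\<And>t. t \<in> K \<Longrightarrow> t div 2 ^ b = c" and c': "\<And>t. t \<in> K' \<Longrightarrow> t div 2 ^ b = c'"
  shows "spread (Suc b) (K \<union> K') = spread b K + spread b K' + D (Suc b)"
proof -
  let ?n = "\<lambda>j X. real (card ((\<lambda>t. t div 2 ^ j) ` X))"
  have "?n j (K \<union> K') = ?n j K + ?n j K'" if "j \<le> b" for j
  proof -
    have "(\<lambda>t. t div 2 ^ j) ` K \<inter> (\<lambda>t. t div 2 ^ j) ` K' = {}"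
    proof (rule ccontr)
      assume "\<not> ?thesis"
      then obtain t t' where t: "t \<in> K" "t' \<in> K'" "t div 2 ^ j = t' div 2 ^ j" by auto
      show False using class_eq_mono[OF t(3) that] c[OF t(1)] c'[OF t(2)] \<open>c \<noteq> c'\<close> by simp
    qed
    then show ?thesis using fin by (simp add: image_Un card_Un_disjoint)
  qed
  then have "spread (Suc b) (K \<union> K') =
      (\<Sum>j<Suc b. \<delta> j * (?n j K - 1) + \<delta> j * (?n j K' - 1) + \<delta> j)"
    unfolding spread_def by (intro sum.cong) (auto simp: algebra_simps)
  also have "\<dots> = spread (Suc b) K + spread (Suc b) K' + D (Suc b)"
    by (simp only: sum.distrib sum_\<delta> spread_def)
  finally show ?thesis using spread_Suc_one_class[OF ne(1) c] spread_Suc_one_class[OF ne(2) c'] by simp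
qed

lemma div_power_Suc: "t div 2 ^ Suc b = t div 2 ^ b div (2 :: nat)"
  by (metis div_mult2_eq power_Suc2)

lemma card_split_cases:
  assumes "finite K" "K \<noteq> {}"
  obtains "card K = 1" | "2 \<le> real (card K)"
proof -
  have "0 < card K" using assms by (simp add: card_gt_0_iff)
  then have "card K = 1 \<or> 2 \<le> card K" by linarith
  then show ?thesis using that by auto
qed

text \<open>This serves terminals of one subtree that a star reaches at cost at least
  \<open>D b\<close> each. Two terminals below different children give equality, so
  \<open>\<beta> = 2 - \<sigma>\<close> is sharp. The induction splits \<open>K\<close> between the
  two children.\<close>

lemma spread_le_subtree:
  assumes "finite K" "K \<noteq> {}" "\<And>t. t \<in> K \<Longrightarrow> t div 2 ^ b = c"
  shows "\<beta> * spread b K \<le> (real (card K) - \<sigma>) * D b"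
  using assms
proof (induction b arbitrary: c K)
  case 0
  then show ?case by (simp add: spread_def)
next
  case (Suc b)
  define K1 where "K1 = {t \<in> K. t div 2 ^ b = 2 * c}"
  define K2 where "K2 = {t \<in> K. t div 2 ^ b = 2 * c + 1}"
  have "t div 2 ^ b = 2 * c \<or> t div 2 ^ b = 2 * c + 1" if "t \<in> K" for t
  proof -
    have "t div 2 ^ b div 2 = c" using Suc.prems(3)[OF that] by (simp only: div_power_Suc)
    then show ?thesis by linarith
  qed
  then have K: "K = K1 \<union> K2" by (auto simp: K1_def K2_def)
  have fin: "finite K1" "finite K2" using Suc.prems K by auto
  have disj: "K1 \<inter> K2 = {}" by (auto simp: K1_def K2_def)
  have mono: "(real (card X) - \<sigma>) * D b \<le> (real (card X) - \<sigma>) * D (Suc b)"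
    if "finite X" "X \<noteq> {}" for X :: "nat set"
    using \<sigma>_less that D_mono[of b "Suc b"] card_gt_0_iff[of X] by (intro mult_left_mono) auto
  have one: ?case if "\<And>t. t \<in> K \<Longrightarrow> t div 2 ^ b = c'" for c'
    using Suc.IH[OF Suc.prems(1,2) that] mono[OF Suc.prems(1,2)]
      spread_Suc_one_class[OF Suc.prems(2) that] by simp
  show ?case
  proof (cases "K1 = {} \<or> K2 = {}")
    case True
    then have "K = K1 \<or> K = K2" using K by auto
    then show ?thesis
    proof
      assume "K = K1"
      then show ?thesis by (intro one[of "2 * c"]) (auto simp: K1_def)
    next
      assume "K = K2"
      then show ?thesis by (intro one[of "2 * c + 1"]) (auto simp: K2_def)
    qed
  next
    case False
    define r1 r2 where "r1 = real (card K1)" and "r2 = real (card K2)"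
    have r: "real (card K) = r1 + r2"
      using card_Un_disjoint[OF fin disj] K by (simp add: r1_def r2_def)
    have sp: "spread (Suc b) K = spread b K1 + spread b K2 + D (Suc b)"
      unfolding K using False fin by (intro spread_Suc_two_classes[where c = "2 * c" and c' = "2 * c + 1"])
        (auto simp: K1_def K2_def)
    have b1: "\<beta> * spread b K1 \<le> (r1 - \<sigma>) * D b"
      unfolding r1_def using False by (intro Suc.IH[OF fin(1), of "2 * c"]) (auto simp: K1_def)
    have b2: "\<beta> * spread b K2 \<le> (r2 - \<sigma>) * D b"
      unfolding r2_def using False by (intro Suc.IH[OF fin(2), of "2 * c + 1"]) (auto simp: K2_def)
    have e: "D (Suc b) - D b \<ge> 0" using D_mono[of b "Suc b"] by simp
    note bD = \<beta>_D_le[of b]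
    have half: "\<beta> * D (Suc b) + (x - \<sigma>) * D b \<le> (1 + x - \<sigma>) * D (Suc b)" if "2 \<le> x" for x
    proof -
      have "\<beta> * (D (Suc b) - D b) \<le> (x - \<sigma>) * (D (Suc b) - D b)"
        using that e by (intro mult_right_mono) (auto simp: \<beta>_def)
      then show ?thesis using bD by (simp add: algebra_simps)
    qed
    have full: "\<beta> * D (Suc b) + (x + y - 2 * \<sigma>) * D b \<le> (x + y - \<sigma>) * D (Suc b)" if "2 \<le> x" "2 \<le> y" for x y
    proof -
      have "2 * \<beta> * (D (Suc b) - D b) \<le> (x + y - 2 * \<sigma>) * (D (Suc b) - D b)"
        using that e by (intro mult_right_mono) (auto simp: \<beta>_def)
      moreover have "\<beta> * D (Suc b) + \<sigma> * D (Suc b) = 2 * D (Suc b)" by (simp add: \<beta>_def algebra_simps)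
      ultimately show ?thesis using bD by (simp add: algebra_simps)
    qed
    have "\<beta> * spread b K1 + \<beta> * spread b K2 + \<beta> * D (Suc b) \<le> (r1 + r2 - \<sigma>) * D (Suc b)"
    proof -
      \<comment> \<open>A lone terminal is treated apart: its spread is 0, whereas the induction
        hypothesis would only give \<open>(1 - \<sigma>) * D b\<close>.\<close>
      consider "card K1 = 1" "card K2 = 1" | "card K1 = 1" "2 \<le> r2" | "2 \<le> r1" "card K2 = 1" | "2 \<le> r1" "2 \<le> r2"
        using card_split_cases[OF fin(1)] card_split_cases[OF fin(2)] False unfolding r1_def r2_def by metis
      then show ?thesis
      proof cases
        case 1
        then show ?thesis using spread_single by (simp add: r1_def r2_def \<beta>_def)
      next
        case 2
        then show ?thesis using spread_single[of K1] b2 half[of r2] by (simp add: r1_def)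
      next
        case 3
        then show ?thesis using spread_single[of K2] b1 half[of r1] by (simp add: r2_def add.commute)
      next
        case 4
        then show ?thesis using b1 b2 full[of r1 r2] by (simp add: algebra_simps)
      qed
    qed
    then show ?thesis by (simp add: r sp algebra_simps)
  qed
qed

text \<open>The term \<open>\<sigma> * D (ht x)\<close> is a slack, used up when the subtree below the parent of \<open>x\<close> is
  joined.\<close>

lemma spread_le_star_aux:
  assumes "ht x \<le> b" "0 < ht x" "finite K" "K \<noteq> {}" "K \<subseteq> {..<2 ^ d}"
    and "\<And>t. t \<in> K \<Longrightarrow> t div 2 ^ b = ps x div 2 ^ b"
  shows "\<beta> * spread b K + (if b = ht x then \<sigma> * D (ht x) else 0)
    \<le> (\<Sum>t\<in>K. 2 * D (meet x t) - D (ht x))"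
  using assms
proof (induction b arbitrary: K rule: dec_induct)
  case base
  have "meet x t = ht x" if "t \<in> K" for t
  proof -
    have t: "t < 2 ^ d" using base that by auto
    have "ps x div 2 ^ ht x = ps t div 2 ^ ht x"
      using base.prems(5)[OF that] ps_leaf[OF t] by simp
    then have "meet x t \<le> ht x" using t ht_eq_0_iff[of t] by (intro meet_le) auto
    then show ?thesis using meet_ge[of x t] by simp
  qed
  then have "(\<Sum>t\<in>K. 2 * D (meet x t) - D (ht x)) = real (card K) * D (ht x)" by simp
  then show ?case using spread_le_subtree[OF base.prems(2,3,5)] by (simp add: algebra_simps)
next
  case (step b)
  let ?a = "ht x"
  let ?cost = "\<lambda>X. \<Sum>t\<in>X. 2 * D (meet x t) - D ?a"
  \<comment> \<open>\<open>K1\<close> lies below the ancestor of \<open>x\<close> at height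
    \<open>b\<close>. \<open>K2\<close> lies below the sibling \<open>c'\<close> of that ancestor,
    whose index differs in the last bit, and meets \<open>x\<close> exactly at
    \<open>Suc b\<close>.\<close>
  define K1 where "K1 = {t \<in> K. t div 2 ^ b = ps x div 2 ^ b}"
  define K2 where "K2 = {t \<in> K. t div 2 ^ b \<noteq> ps x div 2 ^ b}"
  define c' where "c' = (if even (ps x div 2 ^ b) then ps x div 2 ^ b + 1 else ps x div 2 ^ b - 1)"
  have c'_neq: "ps x div 2 ^ b \<noteq> c'"
    unfolding c'_def by (cases "ps x div 2 ^ b") auto
  have K: "K = K1 \<union> K2" by (auto simp: K1_def K2_def)
  have fin: "finite K1" "finite K2" using step.prems K by auto
  have disj: "K1 \<inter> K2 = {}" by (auto simp: K1_def K2_def)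
  have sub: "K1 \<subseteq> {..<2 ^ d}" using step.prems K by auto
  have c1: "t div 2 ^ b = ps x div 2 ^ b" if "t \<in> K1" for t using that by (simp add: K1_def)
  have c2: "t div 2 ^ b = c'" if "t \<in> K2" for t
  proof -
    have "t \<in> K" and ne: "t div 2 ^ b \<noteq> ps x div 2 ^ b" using that by (auto simp: K2_def)
    then have "t div 2 ^ b div 2 = ps x div 2 ^ b div 2"
      using step.prems(5)[of t] by (simp only: div_power_Suc)
    then show ?thesis using ne unfolding c'_def by (auto elim!: evenE oddE)
  qed
  have "meet x t = Suc b" if "t \<in> K2" for t
  proof -
    have t: "t < 2 ^ d" "t \<in> K" and ne: "t div 2 ^ b \<noteq> ps x div 2 ^ b"
      using step.prems that by (auto simp: K2_def)
    have "meet x t \<le> Suc b"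
      using step.prems(5)[OF t(2)] ps_leaf[OF t(1)] t ht_eq_0_iff[of t] step.hyps by (intro meet_le) auto
    moreover have "\<not> meet x t \<le> b"
      using class_eq_mono[OF meet_class[of x t], of b] ps_leaf[OF t(1)] ne by auto
    ultimately show ?thesis by simp
  qed
  then have cost2: "?cost K2 = real (card K2) * (2 * D (Suc b) - D ?a)" by simp
  have cost: "?cost K = ?cost K1 + ?cost K2"
    using sum.union_disjoint[OF fin disj] K by simp
  have ab: "D ?a \<le> D b" "D b \<le> D (Suc b)" using step.hyps D_mono by auto
  have IH: "\<beta> * spread b K1 + (if b = ?a then \<sigma> * D ?a else 0) \<le> ?cost K1" if "K1 \<noteq> {}"
    using step.IH[OF step.prems(1) fin(1) that sub c1] by simp
  have b2: "\<beta> * spread b K2 \<le> (real (card K2) - \<sigma>) * D b" if "K2 \<noteq> {}"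
    by (rule spread_le_subtree[OF fin(2) that c2])
  have "\<beta> * spread (Suc b) K \<le> ?cost K"
  proof (cases "K1 = {} \<or> K2 = {}")
    case True
    show ?thesis
    proof (cases "K1 = {}")
      case True
      then have K2: "K2 \<noteq> {}" "K = K2" using step.prems K by auto
      have "\<sigma> * D b \<ge> 0" using \<sigma>_pos D_nonneg[of b] by simp
      then have "\<beta> * spread b K2 \<le> real (card K2) * D b" using b2[OF K2(1)] by (simp add: algebra_simps)
      also have "\<dots> \<le> real (card K2) * (2 * D (Suc b) - D ?a)"
        using ab by (intro mult_left_mono) auto
      finally show ?thesis using cost2 K2 spread_Suc_one_class[OF K2(1) c2] by simp
    next
      case False
      with True have K1: "K1 \<noteq> {}" "K = K1" using K by auto
      have "\<sigma> * D ?a \<ge> 0" using \<sigma>_pos D_nonneg[of ?a] by simp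
      then show ?thesis using IH[OF K1(1)] K1 spread_Suc_one_class[OF K1(1) c1] by (auto split: if_splits)
    qed
  next
    case False
    then have ne: "K1 \<noteq> {}" "K2 \<noteq> {}" by auto
    have sp: "spread (Suc b) K = spread b K1 + spread b K2 + D (Suc b)"
      unfolding K by (rule spread_Suc_two_classes[OF fin ne c'_neq c1 c2])
    have D_pos_a: "0 < D ?a" using step.prems D_pos by simp
    have "\<beta> * spread b K2 + \<beta> * D (Suc b) \<le> ?cost K2 + (if b = ?a then \<sigma> * D ?a else 0)"
      using fin(2) ne(2)
    proof (cases rule: card_split_cases)
      case 1
      \<comment> \<open>At \<open>b = ht x\<close> this is an equality by the choice of
        \<open>\<sigma>\<close>. Higher up, \<open>Suc b\<close> is at least two levels above the
        centre, and \<open>D ?a \<le> \<sigma> * D (Suc b)\<close> replaces the slack.\<close>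
      have "\<beta> * D (Suc b) \<le> 2 * D (Suc b) - D ?a + (if b = ?a then \<sigma> * D ?a else 0)"
      proof (cases "b = ?a")
        case True
        have "\<sigma> * (lam * D ?a) + \<sigma> * D ?a = (\<sigma> * lam + \<sigma>) * D ?a" by (simp add: algebra_simps)
        then have "\<sigma> * D (Suc ?a) + \<sigma> * D ?a = D ?a"
          using D_Suc[OF step.prems(1)] \<sigma>_lam by simp
        then show ?thesis using True by (simp add: \<beta>_def algebra_simps)
      next
        case False
        then have "D (Suc (Suc ?a)) \<le> D (Suc b)" using step.hyps by (intro D_mono) auto
        then have "lam\<^sup>2 * D ?a \<le> D (Suc b)"
          using step.prems(1) by (simp add: D_Suc power2_eq_square mult.assoc)
        then have "\<sigma> * (lam\<^sup>2 * D ?a) \<le> \<sigma> * D (Suc b)" using \<sigma>_pos by simp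
        moreover have "D ?a \<le> (\<sigma> * lam\<^sup>2) * D ?a"
          using mult_right_mono[OF \<sigma>_lam2 D_nonneg[of ?a]] by simp
        ultimately show ?thesis using False by (simp add: \<beta>_def algebra_simps)
      qed
      then show ?thesis using 1 cost2 spread_single[of K2] by simp
    next
      case 2
      let ?r = "real (card K2)"
      \<comment> \<open>The surplus grows with \<open>?r\<close>, so two terminals are the worst
        case. Estimating \<open>D ?a\<close> by \<open>D b\<close> leaves the inequality shown next,
        which follows from \<open>\<beta>_D_le\<close> and
        \<open>(\<beta> - 1) * (2 - \<beta>) \<ge> 0\<close>.\<close>
      have "2 * (2 * D (Suc b) - D ?a - D b) \<le> ?r * (2 * D (Suc b) - D ?a - D b)"
        using 2 ab by (intro mult_right_mono) auto
      moreover have "(2 + \<beta>) * D b \<le> (2 + \<sigma>) * D (Suc b)"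
      proof -
        have "0 \<le> (\<beta> - 1) * (2 - \<beta>)" using \<beta>_gt_1 \<beta>_less_2 by simp
        then have "2 + \<beta> \<le> (2 + \<sigma>) * \<beta>" by (simp add: \<beta>_def algebra_simps)
        then have "(2 + \<beta>) * D b \<le> (2 + \<sigma>) * \<beta> * D b" using D_nonneg by (intro mult_right_mono)
        also have "\<dots> \<le> (2 + \<sigma>) * D (Suc b)" using \<beta>_D_le[of b] \<sigma>_pos by simp
        finally show ?thesis .
      qed
      moreover have "0 \<le> \<sigma> * D ?a" using \<sigma>_pos D_nonneg[of ?a] by simp
      ultimately show ?thesis using b2[OF ne(2)] ab unfolding cost2
        by (auto simp: \<beta>_def algebra_simps)
    qed
    then show ?thesis using IH[OF ne(1)] cost by (simp add: sp algebra_simps)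
  qed
  then show ?case using step.hyps by simp
qed

lemma spread_le_star:
  assumes "0 < ht x" "finite K" "K \<noteq> {}" "K \<subseteq> {..<2 ^ d}"
  shows "\<beta> * spread d K \<le> (\<Sum>t\<in>K. 2 * D (meet x t) - D (ht x))"
proof -
  have "t div 2 ^ d = ps x div 2 ^ d" if "t \<in> K" for t using that assms ps_less[of x] by auto
  then have "\<beta> * spread d K + (if d = ht x then \<sigma> * D (ht x) else 0)
      \<le> (\<Sum>t\<in>K. 2 * D (meet x t) - D (ht x))"
    using assms ht_le by (intro spread_le_star_aux) auto
  moreover have "0 \<le> \<sigma> * D (ht x)" using \<sigma>_pos D_nonneg[of "ht x"] by simp
  ultimately show ?thesis by (auto split: if_splits)
qed

end

section \<open>Steiner trees\<close>

lemma sum_UN_le: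
  fixes f :: "'a \<Rightarrow> real"
  assumes "finite I" "\<And>i. i \<in> I \<Longrightarrow> finite (B i)" "\<And>x. 0 \<le> f x"
  shows "sum f (\<Union>i\<in>I. B i) \<le> (\<Sum>i\<in>I. sum f (B i))"
  using assms
proof (induction I rule: finite_induct)
  case (insert i I)
  have "sum f (B i \<union> (\<Union>i\<in>I. B i)) \<le> sum f (B i) + sum f (\<Union>i\<in>I. B i)"
    using insert.prems insert.hyps sum_nonneg[of "B i \<inter> (\<Union>i\<in>I. B i)" f]
      sum.union_inter[of "B i" "\<Union>i\<in>I. B i" f] by simp
  then show ?case using insert by simp
qed simp

abbreviation joined :: "(nat \<times> nat) set \<Rightarrow> nat \<Rightarrow> nat \<Rightarrow> bool" where
  "joined B \<equiv> (\<lambda>x y. (x, y) \<in> B \<or> (y, x) \<in> B)\<^sup>*\<^sup>*"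

lemma joined_edge: "(x, y) \<in> B \<Longrightarrow> joined B x y" "(x, y) \<in> B \<Longrightarrow> joined B y x"
  by (auto intro: r_into_rtranclp)

lemma joined_mono: "joined B x y \<Longrightarrow> B \<subseteq> C \<Longrightarrow> joined C x y"
  by (erule rtranclp_mono[THEN predicate2D, rotated]) auto

lemma joined_commute: "joined B x y \<longleftrightarrow> joined B y x"
proof -
  have "symp (joined B)" by (intro symp_rtranclp sympI) auto
  then show ?thesis by (auto dest: sympD)
qed

context tree_metric
begin

section \<open>Replacing tree edges by star edges\<close>

text \<open>For an inner \<open>a\<close> and a leaf \<open>t\<close> this is
  \<open>w {} a t\<close>; a star edge is stored as the pair of its centre and its terminal.\<close>

definition star_cost :: "nat \<times> nat \<Rightarrow> real" where
  "star_cost = (\<lambda>(a, t). 2 * D (meet a t) - D (ht a))"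

lemma star_cost_nonneg: "0 \<le> star_cost p"
  using f_le_L[of "fst p" "snd p"] D_nonneg[of "meet (fst p) (snd p)"] by (simp add: star_cost_def case_prod_unfold)

lemma w_empty: "u \<noteq> v \<Longrightarrow> w {} u v = 2 * D (meet u v) - \<bar>D (ht u) - D (ht v)\<bar>"
  by (simp add: w_def)

lemma edge_to_stars_leaf:
  assumes "0 < ht u" "ht v = 0"
  shows "star_cost (u, v) \<le> w {} u v"
proof -
  have "u \<noteq> v" using assms by auto
  then show ?thesis using assms D_nonneg[of "ht u"] by (simp add: w_empty star_cost_def)
qed

text \<open>\<open>ps u\<close>, read as a point, is a leaf below the lower point \<open>u\<close>,
  and the default distance is that of the detour through it.\<close>

lemma edge_to_stars_inner:
  assumes "0 < ht u" "0 < ht v" "D (ht u) \<le> D (ht v)" "u \<noteq> v"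
  shows "star_cost (u, ps u) + star_cost (v, ps u) \<le> w {} u v"
proof -
  have leaf: "ht (ps u) = 0" "ps (ps u) = ps u" using ps_less[of u] ht_eq_0_iff ps_leaf by auto
  have "meet u (ps u) \<le> ht u" by (rule meet_le) (auto simp: leaf)
  then have "D (meet u (ps u)) \<le> D (ht u)" by (rule D_mono)
  moreover have "meet v (ps u) \<le> meet u v"
    using meet_ge[of u v] meet_class[of u v] by (intro meet_le) (auto simp: leaf)
  then have "D (meet v (ps u)) \<le> D (meet u v)" by (rule D_mono)
  ultimately show ?thesis using assms by (simp add: star_cost_def w_empty)
qed

text \<open>An edge from an inner point to a leaf is a star edge already. Two leaves are joined
  through a point of their lowest common ancestor, two inner points through a leaf below the lower
  one.\<close>

lemma edge_to_stars:
  assumes "u \<in> V" "v \<in> V" "u \<noteq> v"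
  shows "\<exists>B. finite B \<and> B \<subseteq> {a. 0 < ht a} \<times> {..<2 ^ d} \<and> sum star_cost B \<le> w {} u v \<and> joined B u v"
proof -
  have ne: "u \<noteq> v" by fact
  consider "0 < ht u" "ht v = 0" | "ht u = 0" "0 < ht v" | "ht u = 0" "ht v = 0"
    | "0 < ht u" "0 < ht v" "D (ht u) \<le> D (ht v)" | "0 < ht u" "0 < ht v" "D (ht v) \<le> D (ht u)"
    by linarith
  then show ?thesis
  proof cases
    case 1
    then show ?thesis using edge_to_stars_leaf[of u v] assms joined_edge[of u v "{(u, v)}"] ht_eq_0_iff[of v]
      by (intro exI[of _ "{(u, v)}"]) auto
  next
    case 2
    then show ?thesis using edge_to_stars_leaf[of v u] assms joined_edge[of v u "{(v, u)}"] ht_eq_0_iff[of u]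
        w_commute[of "{}" u v]
      by (intro exI[of _ "{(v, u)}"]) auto
  next
    case 3
    let ?h = "meet u v"
    have uv: "u < 2 ^ d" "v < 2 ^ d" "ps u = u" "ps v = v" using 3 ht_eq_0_iff ps_leaf by auto
    have cl: "u div 2 ^ ?h = v div 2 ^ ?h" using meet_class[of u v] uv by simp
    have h: "0 < ?h" using cl ne by (cases "?h = 0") auto
    have "u div 2 ^ ?h < 2 ^ (d - ?h)"
      using uv meet_le_d[of u v] by (simp add: div_less_iff_less_mult flip: power_add)
    then obtain a where a: "a \<in> V" "ht a = ?h" "ps a div 2 ^ ?h = u div 2 ^ ?h"
      using inhabited[OF h meet_le_d] by blast
    have "meet a u \<le> ?h" "meet a v \<le> ?h"
      using a uv cl 3 by (auto intro!: meet_le)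
    then have "D (meet a u) \<le> D ?h" "D (meet a v) \<le> D ?h" by (auto intro: D_mono)
    then have "sum star_cost {(a, u), (a, v)} \<le> w {} u v"
      using ne a 3 by (simp add: star_cost_def w_empty)
    moreover have "joined {(a, u), (a, v)} u v"
      using joined_edge(2)[of a u "{(a, u), (a, v)}"] joined_edge(1)[of a v "{(a, u), (a, v)}"]
      by (meson insertI1 insertI2 rtranclp_trans)
    ultimately show ?thesis using a h uv by (intro exI[of _ "{(a, u), (a, v)}"]) auto
  next
    case 4
    have "joined {(u, ps u), (v, ps u)} u v"
      using joined_edge(1)[of u "ps u" "{(u, ps u), (v, ps u)}"] joined_edge(2)[of v "ps u" "{(u, ps u), (v, ps u)}"]
      by (meson insertI1 insertI2 rtranclp_trans)
    then show ?thesis using edge_to_stars_inner[OF 4 ne] 4 ne ps_less[of u]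
      by (intro exI[of _ "{(u, ps u), (v, ps u)}"]) auto
  next
    case 5
    have "joined {(v, ps v), (u, ps v)} u v"
      using joined_edge(1)[of u "ps v" "{(v, ps v), (u, ps v)}"] joined_edge(2)[of v "ps v" "{(v, ps v), (u, ps v)}"]
      by (meson insertI1 insertI2 rtranclp_trans)
    then show ?thesis using edge_to_stars_inner[of v u] 5 ne ps_less[of v] w_commute[of "{}" u v]
      by (intro exI[of _ "{(v, ps v), (u, ps v)}"]) auto
  qed
qed

text \<open>At each height \<open>j\<close> the stars act as hyperedges that connect the
  \<open>2 ^ (d - j)\<close> classes, which bounds their class counts from below. Weighting by
  \<open>\<delta> j\<close> and exchanging the sums produces the spreads of the stars.\<close>

lemma stars_lower_bound:
  assumes fin: "finite B" and sub: "B \<subseteq> {a. 0 < ht a} \<times> {..<2 ^ d}"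
    and conn: "\<And>s t. \<lbrakk>s < 2 ^ d; t < 2 ^ d\<rbrakk> \<Longrightarrow> joined B s t"
  shows "\<beta> * (\<Sum>j<d. \<delta> j * (2 ^ (d - j) - 1)) \<le> sum star_cost B"
proof -
  define A where "A = fst ` B"
  define K where "K a = B `` {a}" for a
  have A: "finite A" using fin by (simp add: A_def)
  have A_ht: "0 < ht a" if "a \<in> A" for a using that sub by (auto simp: A_def)
  have K: "finite (K a)" "K a \<subseteq> {..<2 ^ d}" for a using fin sub by (auto simp: K_def)
  have K_ne: "K a \<noteq> {}" if "a \<in> A" for a using that by (force simp: A_def K_def)
  have B: "B = Sigma A K" by (force simp: A_def K_def)
  let ?n = "\<lambda>j X. card ((\<lambda>t. t div 2 ^ j) ` X)"
  have count: "2 ^ (d - j) - 1 \<le> (\<Sum>a\<in>A. real (?n j (K a)) - 1)" if "j < d" for j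
  proof -
    let ?q = "\<lambda>t::nat. t div 2 ^ j"
    have Q: "{..<2 ^ (d - j)} \<subseteq> ?q ` {..<2 ^ d}"
    proof
      fix i :: nat assume "i \<in> {..<2 ^ (d - j)}"
      then have "i * 2 ^ j < 2 ^ (d - j) * 2 ^ j" by simp
      also have "\<dots> = 2 ^ d" using that by (simp flip: power_add)
      finally show "i \<in> ?q ` {..<2 ^ d}" by (intro image_eqI[of _ _ "i * 2 ^ j"]) auto
    qed
    have "card (?q ` {..<2 ^ d}) \<le> card {0::nat} + (\<Sum>a\<in>A. card (?q ` K a) - 1)"
    proof (rule card_le_sum_connecting_hyperedges)
      fix Z assume Z: "{0} \<subseteq> Z" "\<not> ?q ` {..<2 ^ d} \<subseteq> Z"
      then obtain t where t: "t < 2 ^ d" "?q t \<notin> Z" by auto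
      show "\<exists>a\<in>A. ?q ` K a \<inter> Z \<noteq> {} \<and> \<not> ?q ` K a \<subseteq> Z"
      proof (rule ccontr)
        assume none: "\<not> ?thesis"
        \<comment> \<open>An invariant for walks along star edges from leaf 0: a leaf has its class
          in \<open>Z\<close>, a centre has the classes of all its terminals in \<open>Z\<close>. If
          no star sticks out of \<open>Z\<close>, it carries over to \<open>t\<close>, whose class
          is outside.\<close>
        define inside where "inside x \<longleftrightarrow> (x < 2 ^ d \<longrightarrow> ?q x \<in> Z) \<and> (x \<in> A \<longrightarrow> ?q ` K x \<subseteq> Z)" for x
        have leaf_not_A: "x \<notin> A" if "x < 2 ^ d" for x using A_ht[of x] ht_eq_0_iff[of x] that by auto
        have "inside y" if "joined B 0 y" for y
          using that
        proof (induction rule: rtranclp_induct)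
          case base
          then show ?case using Z leaf_not_A[of 0] by (auto simp: inside_def)
        next
          case (step x y)
          show ?case
          proof (cases "(x, y) \<in> B")
            case True
            then have "x \<in> A" "y \<in> K x" "y < 2 ^ d" using sub by (auto simp: B)
            then show ?thesis using step.IH leaf_not_A[of y] by (auto simp: inside_def)
          next
            case False
            then have "y \<in> A" "x \<in> K y" "x < 2 ^ d" using step.hyps sub by (auto simp: B)
            moreover have "\<not> y < 2 ^ d" using \<open>y \<in> A\<close> leaf_not_A by blast
            moreover have "?q x \<in> Z" using step.IH \<open>x < 2 ^ d\<close> by (auto simp: inside_def)
            ultimately show ?thesis using none unfolding inside_def by blast
          qed
        qed
        then show False using conn[of 0 t] t by (simp add: inside_def)
      qed
    qed (use A K in auto)
    moreover have "2 ^ (d - j) \<le> card (?q ` {..<2 ^ d})"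
      using card_mono[OF _ Q] by simp
    ultimately have "2 ^ (d - j) \<le> 1 + (\<Sum>a\<in>A. card (?q ` K a) - 1)" by simp
    then have "real (2 ^ (d - j)) \<le> real (1 + (\<Sum>a\<in>A. card (?q ` K a) - 1))" by (rule of_nat_mono)
    also have "\<dots> = 1 + (\<Sum>a\<in>A. real (card (?q ` K a)) - 1)"
    proof -
      have "real (card (?q ` K a) - 1) = real (card (?q ` K a)) - 1" if "a \<in> A" for a
        using K K_ne[OF that] by (subst of_nat_diff) (auto simp: Suc_le_eq card_gt_0_iff)
      then show ?thesis by simp
    qed
    finally show ?thesis by simp
  qed
  have "(\<Sum>j<d. \<delta> j * (2 ^ (d - j) - 1)) \<le> (\<Sum>j<d. \<delta> j * (\<Sum>a\<in>A. real (?n j (K a)) - 1))"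
    using count \<delta>_pos by (intro sum_mono mult_left_mono) (auto intro: less_imp_le)
  also have "\<dots> = (\<Sum>a\<in>A. spread d (K a))"
    unfolding spread_def sum_distrib_left by (rule sum.swap)
  finally have "\<beta> * (\<Sum>j<d. \<delta> j * (2 ^ (d - j) - 1)) \<le> \<beta> * (\<Sum>a\<in>A. spread d (K a))"
    using \<beta>_gt_1 by simp
  also have "\<dots> \<le> (\<Sum>a\<in>A. \<Sum>t\<in>K a. star_cost (a, t))"
    unfolding sum_distrib_left
  proof (rule sum_mono)
    fix a assume "a \<in> A"
    then show "\<beta> * spread d (K a) \<le> (\<Sum>t\<in>K a. star_cost (a, t))"
      using spread_le_star[OF A_ht K(1) K_ne K(2), of a a] by (simp add: star_cost_def)
  qed
  also have "\<dots> = sum star_cost B"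
    unfolding B using A K by (subst sum.Sigma) auto
  finally show ?thesis .
qed

lemma steiner_tree_edge:
  assumes "steiner_tree V T S E" "e \<in> E"
  obtains u v where "e = {u, v}" "u \<in> V" "v \<in> V" "u \<noteq> v"
proof -
  have "e \<in> {{u, v} | u v. u \<in> S \<and> v \<in> S \<and> u \<noteq> v}" "S \<subseteq> V"
    using assms unfolding steiner_tree_def is_tree_def by (simp_all add: subset_eq)
  then show ?thesis using that by blast
qed

lemma steiner_tree_cost_lower_bound:
  assumes "steiner_tree V {..<2 ^ d} S E"
  shows "\<beta> * (\<Sum>j<d. \<delta> j * (2 ^ (d - j) - 1)) \<le> tree_cost (w {}) E"
proof -
  have T: "{..<2 ^ d} \<subseteq> S" "S \<subseteq> V"
    and conn: "\<And>u v. \<lbrakk>u \<in> S; v \<in> S\<rbrakk> \<Longrightarrow> (\<lambda>x y. {x, y} \<in> E)\<^sup>*\<^sup>* u v"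
    using assms by (auto simp: steiner_tree_def is_tree_def)
  have "E \<subseteq> Pow V" using steiner_tree_edge[OF assms] by blast
  then have finE: "finite E" using finite_V finite_subset by blast
  define good where "good e B \<longleftrightarrow> finite B \<and> B \<subseteq> {a. 0 < ht a} \<times> {..<2 ^ d} \<and>
      sum star_cost B \<le> w {} (Min e) (Max e) \<and> (\<forall>x y. e = {x, y} \<longrightarrow> joined B x y)" for e B
  have "\<exists>B. good e B" if e: "e \<in> E" for e
  proof -
    obtain u v where uv: "e = {u, v}" "u \<in> V" "v \<in> V" "u \<noteq> v" using steiner_tree_edge[OF assms e] by metis
    obtain B where B: "finite B" "B \<subseteq> {a. 0 < ht a} \<times> {..<2 ^ d}" "sum star_cost B \<le> w {} u v" "joined B u v"
      using edge_to_stars[OF uv(2-4)] by blast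
    have "joined B x y" if "e = {x, y}" for x y
      using that B(4) joined_commute[of B u v] uv by (auto simp: doubleton_eq_iff)
    then show ?thesis using B uv Min_Max_w[of "{}" u v] unfolding good_def by (intro exI[of _ B]) auto
  qed
  then obtain B where "\<And>e. e \<in> E \<Longrightarrow> good e (B e)" by metis
  then have B: "\<And>e. e \<in> E \<Longrightarrow> finite (B e)" "\<And>e. e \<in> E \<Longrightarrow> B e \<subseteq> {a. 0 < ht a} \<times> {..<2 ^ d}"
    "\<And>e. e \<in> E \<Longrightarrow> sum star_cost (B e) \<le> w {} (Min e) (Max e)"
    "\<And>e x y. \<lbrakk>e \<in> E; e = {x, y}\<rbrakk> \<Longrightarrow> joined (B e) x y" unfolding good_def by simp_all
  let ?B = "\<Union>e\<in>E. B e"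
  have conn_B: "joined ?B u v" if "(\<lambda>x y. {x, y} \<in> E)\<^sup>*\<^sup>* u v" for u v
    using that
  proof (induction rule: rtranclp_induct)
    case (step x y)
    have "B {x, y} \<subseteq> ?B" using step.hyps by auto
    then have "joined ?B x y" by (rule joined_mono[OF B(4)[OF step.hyps(2) refl]])
    with step.IH show ?case by (rule rtranclp_trans)
  qed simp
  have "\<beta> * (\<Sum>j<d. \<delta> j * (2 ^ (d - j) - 1)) \<le> sum star_cost ?B"
  proof (rule stars_lower_bound)
    show "finite ?B" using finE B(1) by simp
    show "?B \<subseteq> {a. 0 < ht a} \<times> {..<2 ^ d}" using B(2) by (rule UN_least)
    fix s t :: nat assume "s < 2 ^ d" "t < 2 ^ d"
    then have "s \<in> S" "t \<in> S" using T by auto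
    then show "joined ?B s t" by (rule conn_B[OF conn])
  qed
  also have "\<dots> \<le> (\<Sum>e\<in>E. sum star_cost (B e))"
    using finE B star_cost_nonneg by (intro sum_UN_le) auto
  also have "\<dots> \<le> tree_cost (w {}) E" unfolding tree_cost_def using B by (intro sum_mono) auto
  finally show ?thesis .
qed

text \<open>\<open>Min\<close> in \<open>ST\<close> is meaningful only on a finite set; the edge
  sets are subsets of \<open>Pow V\<close>.\<close>

lemma finite_tree_costs: "finite {tree_cost c E | S E. steiner_tree V T S E}"
proof -
  have "{tree_cost c E | S E. steiner_tree V T S E} \<subseteq> tree_cost c ` Pow (Pow V)"
    using steiner_tree_edge by blast
  then show ?thesis using finite_V by (meson finite_Pow_iff finite_imageI finite_subset)
qed

section \<open>The Steiner tree of a planted instance\<close>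

text \<open>\<open>U a i\<close> stands for the chosen point of node \<open>i\<close> at height
  \<open>a\<close>, so this is the chosen point of the parent node.\<close>

definition parent :: "(nat \<Rightarrow> nat \<Rightarrow> nat) \<Rightarrow> nat \<Rightarrow> nat" where
  "parent U x = U (Suc (ht x)) (ps x div 2 ^ Suc (ht x))"

text \<open>Leaves represent only themselves, so \<open>U 0 t = t\<close> and the terminals are
  chosen points. Linking a chosen point to its parent costs \<open>\<delta> (ht x)\<close>, as both
  ends lie in \<open>P\<close>.\<close>

lemma planted_tree:
  fixes U :: "nat \<Rightarrow> nat \<Rightarrow> nat"
  assumes U: "\<And>a i. \<lbrakk>a \<le> d; i < 2 ^ (d - a)\<rbrakk> \<Longrightarrow> U a i \<in> V \<and> ht (U a i) = a \<and> ps (U a i) div 2 ^ a = i"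
    and P: "P = (\<lambda>(a, i). U a i) ` (SIGMA a:{..d}. {..<2 ^ (d - a)})"
  shows "steiner_tree V {..<2 ^ d} P ((\<lambda>x. {x, parent U x}) ` (P - {U d 0}))"
    and "tree_cost (w P) ((\<lambda>x. {x, parent U x}) ` (P - {U d 0})) \<le> (\<Sum>j<d. 2 ^ (d - j) * \<delta> j)"
    and "transversal P"
proof -
  have P_iff: "x \<in> P \<longleftrightarrow> (\<exists>a i. a \<le> d \<and> i < 2 ^ (d - a) \<and> x = U a i)" for x
    unfolding P by auto
  have self: "x = U (ht x) (ps x div 2 ^ ht x)" if "x \<in> P" for x
    using that U unfolding P_iff by auto
  then show "transversal P" unfolding transversal_def by metis
  have U_leaf: "U 0 t = t" if "t < 2 ^ d" for t
    using U[of 0 t] that ht_eq_0_iff[of "U 0 t"] ps_leaf[of "U 0 t"] by simp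
  have T: "{..<2 ^ d} \<subseteq> P"
  proof
    fix t :: nat assume "t \<in> {..<2 ^ d}"
    then show "t \<in> P" unfolding P_iff using U_leaf by (intro exI[of _ 0] exI[of _ t]) auto
  qed
  have top_in: "U d 0 \<in> P" unfolding P_iff by (intro exI[of _ d] exI[of _ 0]) auto
  have below: "ht x < d" if "x \<in> P" "x \<noteq> U d 0" for x
  proof -
    have "ht x \<noteq> d" using self[OF that(1)] that ps_less[of x] by auto
    then show ?thesis using ht_le[of x] by simp
  qed
  have par: "parent U x \<in> P" "ht (parent U x) = Suc (ht x)"
    "ps (parent U x) div 2 ^ Suc (ht x) = ps x div 2 ^ Suc (ht x)" if "x \<in> P" "x \<noteq> U d 0" for x
  proof -
    have h: "Suc (ht x) \<le> d" using below[OF that] by simp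
    have "ps x < 2 ^ (d - Suc (ht x)) * 2 ^ Suc (ht x)"
      using ps_less[of x] h by (simp flip: power_add del: power_Suc)
    then have i: "ps x div 2 ^ Suc (ht x) < 2 ^ (d - Suc (ht x))"
      by (rule less_mult_imp_div_less)
    show "parent U x \<in> P" unfolding P_iff parent_def using h i by blast
    show "ht (parent U x) = Suc (ht x)" "ps (parent U x) div 2 ^ Suc (ht x) = ps x div 2 ^ Suc (ht x)"
      unfolding parent_def using U[OF h i] by auto
  qed
  have "is_tree P ((\<lambda>x. {x, parent U x}) ` (P - {U d 0}))"
    using par ht_le top_in by (intro is_treeI_parent[where r = ht and b = d]) auto
  moreover have "P \<subseteq> V" using U by (auto simp: P_iff)
  ultimately show "steiner_tree V {..<2 ^ d} P ((\<lambda>x. {x, parent U x}) ` (P - {U d 0}))"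
    using T by (simp add: steiner_tree_def)
  have w_par: "w P x (parent U x) = \<delta> (ht x)" if "x \<in> P - {U d 0}" for x
  proof -
    have x: "x \<in> P" "x \<noteq> U d 0" using that by auto
    have "meet x (parent U x) \<le> Suc (ht x)" using par[OF x] by (intro meet_le) auto
    then have "meet x (parent U x) = Suc (ht x)" using meet_ge[of x "parent U x"] par(2)[OF x] by simp
    moreover have "x \<noteq> parent U x" using par(2)[OF x] by auto
    ultimately show ?thesis using x par[OF x] by (simp add: w_def \<delta>_def)
  qed
  let ?I = "SIGMA a:{..<d}. {..<2 ^ (d - a) :: nat}"
  have finP: "finite P" unfolding P by auto
  have "tree_cost (w P) ((\<lambda>x. {x, parent U x}) ` (P - {U d 0}))
      \<le> (\<Sum>x\<in>P - {U d 0}. w P (Min {x, parent U x}) (Max {x, parent U x}))"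
    unfolding tree_cost_def using finP w_nonneg by (intro order.trans[OF sum_image_le]) auto
  also have "\<dots> = (\<Sum>x\<in>P - {U d 0}. \<delta> (ht x))"
    using w_par by (intro sum.cong) (auto simp: Min_Max_w simp del: Min_insert Max_insert)
  also have "\<dots> \<le> sum (\<lambda>x. \<delta> (ht x)) ((\<lambda>(a, i). U a i) ` ?I)"
  proof (rule sum_mono2)
    show "P - {U d 0} \<subseteq> (\<lambda>(a, i). U a i) ` ?I"
    proof
      fix x assume "x \<in> P - {U d 0}"
      then have "x \<in> P" "x \<noteq> U d 0" by auto
      then obtain a i where ai: "a \<le> d" "i < 2 ^ (d - a)" "x = U a i" "x \<noteq> U d 0" unfolding P_iff by auto
      then have "a < d" by (cases "a = d") auto
      then show "x \<in> (\<lambda>(a, i). U a i) ` ?I" using ai by (intro image_eqI[of _ _ "(a, i)"]) auto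
    qed
  qed (use \<delta>_pos in \<open>auto intro: less_imp_le\<close>)
  also have "\<dots> \<le> (\<Sum>(a, i)\<in>?I. \<delta> (ht (U a i)))"
    using \<delta>_pos by (intro order.trans[OF sum_image_le]) (auto simp: case_prod_unfold intro: less_imp_le)
  also have "\<dots> = (\<Sum>(a, i)\<in>?I. \<delta> a)" using U by (intro sum.cong) auto
  also have "\<dots> = (\<Sum>j<d. 2 ^ (d - j) * \<delta> j)" by (subst sum.Sigma[symmetric]) auto
  finally show "tree_cost (w P) ((\<lambda>x. {x, parent U x}) ` (P - {U d 0})) \<le> (\<Sum>j<d. 2 ^ (d - j) * \<delta> j)" .
qed

end

section \<open>Separation and query bound\<close>

text \<open>This is \<open>1 + 1/32 \<le> exp (1/32)\<close> raised to the power 96; in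
  \<open>separation\<close> it yields \<open>19 * x \<le> 1\<close>.\<close>

lemma exp_3_ge: "19 \<le> exp (3::real)"
proof -
  have "(19::real) \<le> (1 + 1/32) ^ 96" by (simp add: power_divide)
  also have "\<dots> \<le> exp (1/32) ^ 96" by (intro power_mono exp_ge_add_one_self) auto
  also have "\<dots> = exp 3" by (simp flip: exp_of_nat_mult)
  finally show ?thesis .
qed

text \<open>Fixing two coordinates removes two factors \<open>g\<close>, or leaves nothing if a
  prescribed value is out of range. It bounds the share of planted instances that one query can
  expose.\<close>

lemma card_PiE_two_values:
  fixes g :: nat
  assumes "finite N" "x \<in> N" "y \<in> N" "x \<noteq> y"
  shows "g\<^sup>2 * card {u \<in> PiE N (\<lambda>_. {..<g}). u x = l \<and> u y = m} \<le> card (PiE N (\<lambda>_. {..<g}))"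
proof -
  let ?F = "\<lambda>z. if z = x then {l} else if z = y then {m} else {..<g}"
  have N: "N = insert x (insert y (N - {x, y}))" using assms by auto
  have prod: "(\<Prod>z\<in>N. h z) = h x * (h y * (\<Prod>z\<in>N - {x, y}. h z))" for h :: "'a \<Rightarrow> nat"
    using assms by (subst N) auto
  have "card {u \<in> PiE N (\<lambda>_. {..<g}). u x = l \<and> u y = m} \<le> card (PiE N ?F)"
    using assms by (intro card_mono finite_PiE) (auto simp: PiE_iff extensional_def)
  also have "\<dots> = (\<Prod>z\<in>N - {x, y}. g)"
    using assms by (subst card_PiE) (auto simp: prod intro!: prod.cong)
  finally have "g\<^sup>2 * card {u \<in> PiE N (\<lambda>_. {..<g}). u x = l \<and> u y = m} \<le> g\<^sup>2 * (\<Prod>z\<in>N - {x, y}. g)"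
    by (rule mult_le_mono2)
  also have "\<dots> = card (PiE N (\<lambda>_. {..<g}))"
    using assms by (subst card_PiE) (auto simp only: prod card_lessThan power2_eq_square mult.assoc)
  finally show ?thesis .
qed

text \<open>A finite infimum in \<open>enat\<close> is attained, since that of the empty set is
  infinite.\<close>

lemma worst_case_queries_attained:
  assumes "worst_case_queries A n k = enat q" "st_instance n k V T w"
  shows "AE t in A V T. num_queries t w \<le> q"
proof -
  let ?S = "{q. \<forall>V T w. st_instance n k V T w \<longrightarrow> (AE t in A V T. enat (num_queries t w) \<le> q)}"
  have "Inf ?S = enat q" using assms(1) by (simp add: worst_case_queries_def)
  then have "enat q \<in> ?S" by (metis (mono_tags, lifting) Inf_enat_def LeastI ex_in_conv enat.distinct(1))
  then show ?thesis using assms(2) by simp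
qed

context tree_metric
begin

section \<open>The cost gap between planted and unplanted instances\<close>

text \<open>The length of the whole tree: each of the \<open>2 ^ (d - j)\<close> nodes of height
  \<open>j\<close> has an edge to its parent.\<close>

definition Y :: real where "Y = (\<Sum>j<d. 2 ^ (d - j) * \<delta> j)"

lemma ST_planted_le:
  assumes "\<And>a i. \<lbrakk>a \<le> d; i < 2 ^ (d - a)\<rbrakk> \<Longrightarrow> U a i \<in> V \<and> ht (U a i) = a \<and> ps (U a i) div 2 ^ a = i"
    and "P = (\<lambda>(a, i). U a i) ` (SIGMA a:{..d}. {..<2 ^ (d - a)})"
  shows "ST V {..<2 ^ d} (w P) \<le> Y"
proof -
  note tree = planted_tree[OF assms]
  have "ST V {..<2 ^ d} (w P) \<le> tree_cost (w P) ((\<lambda>x. {x, parent U x}) ` (P - {U d 0}))"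
    unfolding ST_def using tree(1) by (intro Min_le[OF finite_tree_costs]) blast
  then show ?thesis using tree(2) by (simp add: Y_def)
qed

text \<open>The loss of \<open>D d\<close> collects the \<open>- 1\<close> at every height in
  \<open>steiner_tree_cost_lower_bound\<close>. The given Steiner tree makes the set under
  \<open>Min\<close> non-empty.\<close>

lemma ST_unplanted_ge:
  assumes "steiner_tree V {..<2 ^ d} S E"
  shows "\<beta> * (Y - D d) \<le> ST V {..<2 ^ d} (w {})"
proof -
  have "(\<Sum>j<d. \<delta> j * (2 ^ (d - j) - 1)) = Y - D d"
    unfolding Y_def sum_\<delta>[symmetric] by (simp add: algebra_simps sum_subtractf)
  then have "\<beta> * (Y - D d) \<le> tree_cost (w {}) E'" if "steiner_tree V {..<2 ^ d} S' E'" for S' E'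
    using steiner_tree_cost_lower_bound[OF that] by simp
  moreover have "ST V {..<2 ^ d} (w {}) \<in> {tree_cost (w {}) E | S E. steiner_tree V {..<2 ^ d} S E}"
    unfolding ST_def using assms by (intro Min_in finite_tree_costs) blast
  ultimately show ?thesis by auto
qed

lemma Y_pos: "0 < d \<Longrightarrow> 0 < Y"
  unfolding Y_def using \<delta>_pos by (intro sum_pos) auto

text \<open>\<open>Y\<close> is at least \<open>6 * (d - 6) * D d\<close>, and
  \<open>\<beta>\<close> exceeds \<open>5/3 - 1/d\<close> by
  \<open>(d - 6) / (3 * d * (d - 2))\<close>. The product of the two is close to
  \<open>2 * D d\<close>, more than the loss \<open>\<beta> * D d\<close>.\<close>

lemma separation:
  assumes d: "100 \<le> d" and lam_eq: "lam = 2 - 6 / d"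
  shows "(5/3 - 1/d) * Y < \<beta> * (Y - D d)"
proof -
  define r where "r = real d"
  have r: "100 \<le> r" using d by (simp add: r_def)
  \<comment> \<open>\<open>x\<close> is the ratio of \<open>D d\<close> to \<open>2 ^ d\<close>. The
    edges leaving height \<open>j\<close> upwards have total length at least
    \<open>2 ^ d * (lam - 1) * (1 - 3 / r) ^ j\<close>, a geometric progression.\<close>
  define x where "x = (1 - 3 / r) ^ d"
  have lam_half: "lam = 2 * (1 - 3 / r)" using lam_eq by (simp add: r_def)
  have x_pos: "0 < x" unfolding x_def using r by simp
  have "x \<le> exp (- 3 / r) ^ d"
    unfolding x_def using r exp_ge_add_one_self[of "- 3 / r"] by (intro power_mono) auto
  also have "\<dots> = exp (- 3)" using r by (simp add: r_def flip: exp_of_nat_mult)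
  also have "\<dots> \<le> 1 / 19" using exp_3_ge by (simp add: exp_minus field_simps)
  finally have x19: "19 * x \<le> 1" by simp
  have lam_power: "lam ^ j = 2 ^ j * (1 - 3 / r) ^ j" for j
    by (simp only: lam_half power_mult_distrib)
  have Dd: "D d = 2 ^ d * x"
    using d by (simp add: D_def x_def lam_power)
  have geom: "(\<Sum>j<d. (1 - 3 / r) ^ j) = r / 3 * (1 - x)"
    using r by (subst geometric_sum) (auto simp: x_def field_simps)
  have "2 ^ d * ((lam - 1) * (\<Sum>j<d. (1 - 3 / r) ^ j)) \<le> Y"
    unfolding Y_def sum_distrib_left
  proof (rule sum_mono)
    fix j assume j: "j \<in> {..<d}"
    have "(lam - 1) * lam ^ j \<le> \<delta> j"
      using lam by (simp add: \<delta>_def D_def algebra_simps)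
    then have "2 ^ (d - j) * ((lam - 1) * lam ^ j) \<le> 2 ^ (d - j) * \<delta> j" by simp
    moreover have "(2::real) ^ d = 2 ^ (d - j) * 2 ^ j" using j by (simp flip: power_add)
    ultimately show "2 ^ d * ((lam - 1) * (1 - 3 / r) ^ j) \<le> 2 ^ (d - j) * \<delta> j"
      by (simp add: lam_power mult_ac)
  qed
  also have "(lam - 1) * (\<Sum>j<d. (1 - 3 / r) ^ j) = (r - 6) / 3 * (1 - x)"
  proof -
    have "lam - 1 = (r - 6) / r" using r by (simp add: lam_half field_simps)
    then show ?thesis using r by (simp only: geom) simp
  qed
  finally have "2 ^ d * ((r - 6) / 3 * (1 - x)) \<le> Y" .
  moreover have "(r - 6) / 3 * (18 * x) \<le> (r - 6) / 3 * (1 - x)"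
    using x19 r by (intro mult_left_mono) auto
  then have "2 ^ d * ((r - 6) / 3 * (18 * x)) \<le> 2 ^ d * ((r - 6) / 3 * (1 - x))" by simp
  moreover have "6 * (r - 6) * D d = 2 ^ d * ((r - 6) / 3 * (18 * x))" by (simp add: Dd)
  ultimately have Y: "6 * (r - 6) * D d \<le> Y" by linarith
  have \<beta>_eq: "\<beta> = 5/3 - 2 / (3 * (r - 2))"
  proof -
    have "1 + lam = 3 * (r - 2) / r" using r by (simp add: lam_half field_simps)
    then have "\<sigma> = r / (3 * (r - 2))" by (simp add: \<sigma>_def)
    then show ?thesis using r by (simp add: \<beta>_def field_simps)
  qed
  have gap: "\<beta> - (5/3 - 1/r) = (r - 6) / (3 * r * (r - 2))"
    using r unfolding \<beta>_eq by (simp add: field_simps)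
  have Dpos: "0 < D d" using Dd x_pos by simp
  have "\<beta> \<le> 5/3" using r unfolding \<beta>_eq by simp
  then have "\<beta> * D d \<le> 5/3 * D d" using Dpos by simp
  also have "\<dots> < (r - 6) / (3 * r * (r - 2)) * (6 * (r - 6)) * D d"
  proof (rule mult_strict_right_mono[OF _ Dpos])
    \<comment> \<open>The two sides of the next inequality differ by
      \<open>r * r - 62 * r + 216\<close>.\<close>
    have "62 * r \<le> r * r" using r by (intro mult_right_mono) auto
    then have "5 * (r * (r - 2)) < 6 * ((r - 6) * (r - 6))" by (simp add: algebra_simps)
    moreover have "0 < r * (r - 2)" using r by simp
    ultimately show "5/3 < (r - 6) / (3 * r * (r - 2)) * (6 * (r - 6))"
      by (simp add: field_simps)
  qed
  also have "\<dots> = (r - 6) / (3 * r * (r - 2)) * (6 * (r - 6) * D d)" by simp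
  also have "\<dots> \<le> (r - 6) / (3 * r * (r - 2)) * Y"
    using r Y by (intro mult_left_mono) auto
  finally have "\<beta> * D d < (\<beta> - (5/3 - 1/r)) * Y" by (simp only: gap)
  then show ?thesis by (simp add: r_def algebra_simps)
qed

end

section \<open>The family of planted instances and the final bound\<close>

lemma sum_card_levels: "(\<Sum>a\<in>{1..d}. 2 ^ (d - a)) \<le> (2 ^ d :: nat)"
proof -
  have "(\<Sum>a\<in>{1..d}. 2 ^ (d - a)) = (\<Sum>k\<in>{0..<d}. 2 ^ k :: nat)"
    by (rule sum.reindex_bij_witness[of _ "\<lambda>k. d - k" "\<lambda>a. d - a"]) auto
  then show ?thesis by (simp add: sum_power2)
qed

lemma query_bound:
  fixes d n :: nat and p \<epsilon> :: real
  assumes d: "100 \<le> d" and n: "4 * 2 ^ d \<le> n" and \<epsilon>: "1 / d \<le> \<epsilon>" "\<epsilon> < 2/3" and p: "1/2 < p"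
    and est: "estimates_ST A n (2 ^ d) (5/3 - \<epsilon>) p" and q: "worst_case_queries A n (2 ^ d) = enat q"
  shows "(2 * p - 1) * (real n / 2 ^ (d + 1))\<^sup>2 \<le> q"
proof -
  define N :: "(nat \<times> nat) set" where "N = (SIGMA a:{1..d}. {..<2 ^ (d - a)})"
  have finN: "finite N" by (simp add: N_def)
  \<comment> \<open>The inner nodes fit into the residues modulo \<open>2 ^ d\<close>. A point from
    \<open>2 ^ d\<close> on represents the node coded by its residue, and residues that code no node
    fall to the root.\<close>
  have "card N \<le> card {..<2 ^ d :: nat}"
    using sum_card_levels[of d] by (simp add: N_def)
  then obtain enc where enc: "enc ` N \<subseteq> {..<2 ^ d :: nat}" "inj_on enc N"
    using card_le_inj[OF finN] by blast
  define node where "node v = (if v < 2 ^ d then (0, v)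
    else if v mod 2 ^ d \<in> enc ` N then inv_into N enc (v mod 2 ^ d) else (d, 0))" for v
  define ht where "ht v = fst (node v)" for v
  define ps where "ps v = snd (node v) * 2 ^ fst (node v)" for v
  define lam :: real where "lam = 2 - 6 / d"
  define V where "V = {..<n}"
  \<comment> \<open>The number of complete blocks of \<open>2 ^ d\<close> labels after the
    terminals; each block holds one copy of every inner node.\<close>
  define g where "g = n div 2 ^ d - 1"
  have node_N: "node v \<in> N" if "\<not> v < 2 ^ d" for v
    using that d inv_into_into[of "v mod 2 ^ d" enc N] by (auto simp: node_def N_def)
  have n_ge: "4 \<le> n div 2 ^ d"
    using div_le_mono[OF n, of "2 ^ d"] by simp
  have label: "2 ^ d * (l + 1) + enc x < n \<and> node (2 ^ d * (l + 1) + enc x) = x" if "l < g" "x \<in> N" for l x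
  proof -
    have e: "enc x < 2 ^ d" using enc that by auto
    have "2 ^ d * (l + 1) + enc x < 2 ^ d * (l + 2)" using e by simp
    also have "\<dots> \<le> 2 ^ d * (n div 2 ^ d)" using that by (intro mult_le_mono2) (simp add: g_def)
    also have "\<dots> \<le> n" by simp
    finally have "2 ^ d * (l + 1) + enc x < n" .
    moreover have "(2 ^ d * (l + 1) + enc x) mod 2 ^ d = enc x" using e by (simp only: mod_mult_self4 mod_less)
    ultimately show ?thesis using enc that by (simp add: node_def)
  qed
  \<comment> \<open>The value is \<open>2 - 6 / 100\<close>, above the golden ratio.\<close>
  have lam194: "1.94 \<le> lam" using d by (simp add: lam_def field_simps)
  interpret tree_metric d lam ht ps V
  proof
    show "1 < lam" using lam194 by simp
    have "lam * 1.94 \<le> lam\<^sup>2" unfolding power2_eq_square using lam194 by (intro mult_left_mono) auto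
    then show "lam + 1 \<le> lam\<^sup>2" using lam194 by simp
    fix v
    show "ht v \<le> d" using node_N[of v] by (auto simp: ht_def N_def node_def)
    show "ps v < 2 ^ d"
    proof (cases "v < 2 ^ d")
      case False
      then obtain a i where ai: "node v = (a, i)" "a \<le> d" "i < 2 ^ (d - a)"
        using node_N[of v] by (cases "node v") (auto simp: N_def)
      then have "i * 2 ^ a < 2 ^ (d - a) * 2 ^ a" by simp
      then show ?thesis using ai by (simp add: ps_def flip: power_add)
    qed (simp add: ps_def node_def)
    show "ht v = 0 \<longleftrightarrow> v < 2 ^ d" using node_N[of v] by (auto simp: ht_def N_def node_def)
    show "ps v = v" if "v < 2 ^ d" using that by (simp add: ps_def node_def)
  next
    show "finite V" by (simp add: V_def)
    fix a i :: nat assume "0 < a" "a \<le> d" "i < 2 ^ (d - a)"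
    then have "(a, i) \<in> N" by (simp add: N_def)
    moreover have "0 < g" using n_ge by (simp add: g_def)
    ultimately show "\<exists>v\<in>V. ht v = a \<and> ps v div 2 ^ a = i"
      using label[of 0 "(a, i)"] by (intro bexI[of _ "2 ^ d * (0 + 1) + enc (a, i)"]) (auto simp: ht_def ps_def V_def)
  qed
  let ?T = "{..<2 ^ d :: nat}"
  \<comment> \<open>A choice \<open>u\<close> names for every inner node the block of its secret
    copy; the \<open>+ 1\<close> in \<open>U\<close> skips the block of the terminals.\<close>
  define \<Omega> where "\<Omega> = PiE N (\<lambda>_. {..<g})"
  define U where "U u a i = (if a = 0 then i else 2 ^ d * (u (a, i) + 1) + enc (a, i))" for u and a i :: nat
  define P where "P u = (\<lambda>(a, i). U u a i) ` (SIGMA a:{..d}. {..<2 ^ (d - a)})" for u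
  have label_U: "U u a i \<in> V \<and> node (U u a i) = (a, i)" if "u \<in> \<Omega>" "a \<le> d" "i < 2 ^ (d - a)" for u a i
  proof (cases "a = 0")
    case True
    then show ?thesis using that n by (auto simp: U_def V_def node_def)
  next
    case False
    then have "(a, i) \<in> N" using that by (simp add: N_def)
    moreover have "u (a, i) < g" using that(1) \<open>(a, i) \<in> N\<close> by (auto simp: \<Omega>_def)
    ultimately show ?thesis using label[of "u (a, i)" "(a, i)"] False by (simp add: U_def V_def)
  qed
  have U: "U u a i \<in> V \<and> ht (U u a i) = a \<and> ps (U u a i) div 2 ^ a = i"
    if "u \<in> \<Omega>" "a \<le> d" "i < 2 ^ (d - a)" for u a i
    using label_U[OF that] by (simp add: ht_def ps_def)
  have fin\<Omega>: "finite \<Omega>" unfolding \<Omega>_def using finN by (intro finite_PiE) auto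
  have "0 < g" using n_ge by (simp add: g_def)
  then have \<Omega>_ne: "\<Omega> \<noteq> {}" unfolding \<Omega>_def by (auto simp: PiE_eq_empty_iff)
  have inst: "st_instance n (2 ^ d) V ?T (w X)" if "transversal X" for X
    using that n Metric_space_w by (auto simp: st_instance_def V_def)
  have inst0: "st_instance n (2 ^ d) V ?T (w {})" by (rule inst) (simp add: transversal_def)
  have instP: "st_instance n (2 ^ d) V ?T (w (P u))" if "u \<in> \<Omega>" for u
    by (rule inst, rule planted_tree(3)[OF U[OF that] P_def])
  \<comment> \<open>If the metrics differ at \<open>a\<close> and \<open>b\<close>, both are chosen
    points of inner nodes, as the two formulas agree when a leaf is involved. The nodes are
    distinct, each having a single chosen point, so two values of \<open>u\<close> are
    prescribed.\<close>
  have planted_pair: "g\<^sup>2 * card {u \<in> \<Omega>. w (P u) a b \<noteq> w {} a b} \<le> card \<Omega>" for a b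
  proof (cases "node a \<in> N \<and> node b \<in> N \<and> node a \<noteq> node b")
    case True
    have "{u \<in> \<Omega>. w (P u) a b \<noteq> w {} a b} \<subseteq>
      {u \<in> \<Omega>. u (node a) = a div 2 ^ d - 1 \<and> u (node b) = b div 2 ^ d - 1}"
    proof clarify
      fix u assume u: "u \<in> \<Omega>" and "w (P u) a b \<noteq> w {} a b"
      then have "a \<in> P u" "b \<in> P u" by (auto simp: w_def split: if_splits)
      moreover have "u (node c) = c div 2 ^ d - 1" if "c \<in> P u" "node c \<in> N" for c
      proof -
        obtain a i where ai: "a \<le> d" "i < 2 ^ (d - a)" "c = U u a i" using \<open>c \<in> P u\<close> by (auto simp: P_def)
        then have "node c = (a, i)" using label_U[OF u] by simp
        moreover have "a \<noteq> 0" using that calculation by (auto simp: N_def)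
        moreover have "enc (a, i) < 2 ^ d" using that calculation enc by auto
        ultimately have c: "c = 2 ^ d * (u (a, i) + 1) + enc (a, i)" and e: "enc (a, i) < 2 ^ d"
          and node_c: "node c = (a, i)" using ai by (auto simp: U_def)
        have "c div 2 ^ d = u (a, i) + 1" unfolding c using e by (subst div_mult_self4) auto
        then show ?thesis using node_c by simp
      qed
      ultimately show "u (node a) = a div 2 ^ d - 1 \<and> u (node b) = b div 2 ^ d - 1" using True by simp
    qed
    then have "g\<^sup>2 * card {u \<in> \<Omega>. w (P u) a b \<noteq> w {} a b} \<le>
        g\<^sup>2 * card {u \<in> \<Omega>. u (node a) = a div 2 ^ d - 1 \<and> u (node b) = b div 2 ^ d - 1}"
      using fin\<Omega> by (intro mult_le_mono2 card_mono) auto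
    also have "\<dots> \<le> card \<Omega>"
      unfolding \<Omega>_def using True finN by (intro card_PiE_two_values) auto
    finally show ?thesis .
  next
    case False
    have "w (P u) a b = w {} a b" if u: "u \<in> \<Omega>" for u
    proof (rule ccontr)
      assume neq: "w (P u) a b \<noteq> w {} a b"
      then have ab: "a \<noteq> b" "a \<in> P u" "b \<in> P u" by (auto simp: w_def split: if_splits)
      have "0 < ht a" "0 < ht b"
        using neq ab D_nonneg[of "ht a"] D_nonneg[of "ht b"] by (auto simp: w_def intro!: gr0I)
      then have "node a \<in> N" "node b \<in> N"
        using node_N[of a] ht_eq_0_iff[of a] node_N[of b] ht_eq_0_iff[of b] by simp_all
      obtain i j i' j' where uij: "i \<le> d" "j < 2 ^ (d - i)" "a = U u i j" "i' \<le> d" "j' < 2 ^ (d - i')" "b = U u i' j'"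
        using ab by (auto simp: P_def)
      then have "node a = (i, j)" "node b = (i', j')" using label_U[OF u] by simp_all
      then have "node a \<noteq> node b" using uij ab by auto
      with \<open>node a \<in> N\<close> \<open>node b \<in> N\<close> show False using False by simp
    qed
    then have none: "{u \<in> \<Omega>. w (P u) a b \<noteq> w {} a b} = {}" by auto
    show ?thesis unfolding none by simp
  qed
  let ?\<alpha> = "5/3 - \<epsilon>"
  have rand: "randomized_alg V (A V ?T)" using est inst0 by (auto simp: estimates_ST_def)
  have good: "p \<le> measure (A V ?T) {t \<in> space (A V ?T). ST V ?T c \<le> alg_output t c \<and> alg_output t c \<le> ?\<alpha> * ST V ?T c}"
    if "st_instance n (2 ^ d) V ?T c" for c
    using est that by (auto simp: estimates_ST_def)
  have meas: "(\<lambda>t. alg_output t c) \<in> borel_measurable (A V ?T)" if "st_instance n (2 ^ d) V ?T c" for c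
    using rand that by (auto simp: randomized_alg_def st_instance_def)
  have sep: "?\<alpha> * ST V ?T (w (P u)) < ST V ?T (w {})" if u: "u \<in> \<Omega>" for u
  proof -
    have "?\<alpha> * ST V ?T (w (P u)) \<le> ?\<alpha> * Y"
      using \<epsilon> ST_planted_le[OF U[OF u] P_def] by (intro mult_left_mono) auto
    also have "\<dots> \<le> (5/3 - 1/d) * Y" using \<epsilon> Y_pos d by (intro mult_right_mono) (auto intro: less_imp_le)
    also have "\<dots> < \<beta> * (Y - D d)" using d by (intro separation) (simp_all add: lam_def)
    also have "\<dots> \<le> ST V ?T (w {})" by (rule ST_unplanted_ge[OF planted_tree(1)[OF U[OF u] P_def]])
    finally show ?thesis .
  qed
  have "(2 * p - 1) * real (g\<^sup>2) \<le> q"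
  proof (rule expected_queries_lower_bound[where M = "A V ?T" and I = \<Omega> and w = "\<lambda>u. w (P u)" and ?w0.0 = "w {}"
        and lo = "ST V ?T (w {})" and hi = "?\<alpha> * ST V ?T (w {})"
        and lo' = "\<lambda>u. ST V ?T (w (P u))" and hi' = "\<lambda>u. ?\<alpha> * ST V ?T (w (P u))"])
    show "prob_space (A V ?T)" using rand by (simp add: randomized_alg_def)
    show "AE t in A V ?T. num_queries t (w {}) \<le> q" by (rule worst_case_queries_attained[OF q inst0])
    show "0 < real (g\<^sup>2)" using \<open>0 < g\<close> by simp
    show "real (g\<^sup>2) * real (card {u \<in> \<Omega>. w (P u) a b \<noteq> w {} a b}) \<le> real (card \<Omega>)" for a b
      using planted_pair[of a b] by (simp only: of_nat_le_iff flip: of_nat_mult)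
  qed (use fin\<Omega> \<Omega>_ne sep good meas inst0 instP in auto)
  \<comment> \<open>Rounding down and giving up the first block lose less than 2 from
    \<open>n / 2 ^ d\<close>, which is at most half since that is at least 4.\<close>
  moreover have "(real n / 2 ^ (d + 1))\<^sup>2 \<le> real (g\<^sup>2)"
  proof -
    have "n < 2 ^ d * (n div 2 ^ d + 1)" using dividend_less_times_div[of "2 ^ d" n] by simp
    then have "real n < real (2 ^ d * (n div 2 ^ d + 1))" by (rule of_nat_less_iff[THEN iffD2])
    then have "real n / 2 ^ d < real (n div 2 ^ d) + 1" by (simp add: field_simps)
    moreover have "4 \<le> real n / 2 ^ d"
      using n by (simp add: field_simps flip: of_nat_le_iff[where 'a = real])
    ultimately have "real n / 2 ^ (d + 1) \<le> real g"
      using n_ge by (simp add: g_def of_nat_diff)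
    then show ?thesis using power_mono[of "real n / 2 ^ (d + 1)" "real g" 2] by simp
  qed
  then have "(2 * p - 1) * (real n / 2 ^ (d + 1))\<^sup>2 \<le> (2 * p - 1) * real (g\<^sup>2)"
    using p by (intro mult_left_mono) auto
  ultimately show ?thesis by linarith
qed

theorem theorem1p1:
  shows "\<exists>k :: real \<Rightarrow> nat. \<forall>p::real. 1/2 < p \<and> p < 1 \<longrightarrow>
    (\<exists>c::real. c > 0 \<and>
      (\<forall>\<epsilon>::real. 0 < \<epsilon> \<and> \<epsilon> < 2/3 \<longrightarrow>
        (\<forall>\<^sub>F n in sequentially.
          \<forall>A. estimates_ST A n (k \<epsilon>) (5/3 - \<epsilon>) p \<longrightarrow>
            ereal (c * (real n)\<^sup>2 / 4 powr (1/\<epsilon>))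
              \<le> ereal_of_enat (worst_case_queries A n (k \<epsilon>)))))"
proof -
  \<comment> \<open>Rounding \<open>1/\<epsilon>\<close> up gives
    \<open>1 / d \<le> \<epsilon>\<close>; the added 100 meets the requirement of
    \<open>separation\<close>.\<close>
  define dim :: "real \<Rightarrow> nat" where "dim \<epsilon> = nat \<lceil>1/\<epsilon>\<rceil> + 100" for \<epsilon>
  show ?thesis
  proof (intro exI[of _ "\<lambda>\<epsilon>. 2 ^ dim \<epsilon>"] allI impI)
    fix p :: real assume p: "1/2 < p \<and> p < 1"
    show "\<exists>c>0. \<forall>\<epsilon>. 0 < \<epsilon> \<and> \<epsilon> < 2/3 \<longrightarrow>
        (\<forall>\<^sub>F n in sequentially. \<forall>A. estimates_ST A n (2 ^ dim \<epsilon>) (5/3 - \<epsilon>) p \<longrightarrow>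
            ereal (c * (real n)\<^sup>2 / 4 powr (1/\<epsilon>)) \<le> ereal_of_enat (worst_case_queries A n (2 ^ dim \<epsilon>)))"
    \<comment> \<open>As \<open>dim \<epsilon> + 1 \<le> 1/\<epsilon> + 102\<close>, the factor
      \<open>4 ^ 102\<close> absorbs the rounding, the added 100 and the halving of
      \<open>n / 2 ^ d\<close>. The constant depends on \<open>p\<close> only.\<close>
    proof (intro exI[of _ "(2 * p - 1) / 4 ^ 102"] conjI allI impI)
      show "0 < (2 * p - 1) / 4 ^ 102" using p by simp
      fix \<epsilon> :: real assume \<epsilon>: "0 < \<epsilon> \<and> \<epsilon> < 2/3"
      let ?d = "dim \<epsilon>"
      have d_lo: "1/\<epsilon> \<le> real ?d" "100 \<le> ?d" unfolding dim_def by linarith+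
      have d_hi: "real (?d + 1) \<le> 1/\<epsilon> + 102" using \<epsilon> by (simp add: dim_def, linarith)
      have "4 ^ (?d + 1) = 4 powr real (?d + 1)" by (rule powr_realpow[symmetric]) simp
      also have "\<dots> \<le> 4 powr (1/\<epsilon> + 102)" using d_hi by (intro powr_mono) auto
      also have "\<dots> = 4 ^ 102 * 4 powr (1/\<epsilon>)" by (simp add: powr_add mult.commute)
      finally have pow: "4 ^ (?d + 1) \<le> (4 ^ 102 * 4 powr (1/\<epsilon>) :: real)" .
      have "1 / ?d \<le> \<epsilon>" using d_lo \<epsilon> by (simp add: field_simps)
      note bound = query_bound[OF d_lo(2) _ this]
      show "\<forall>\<^sub>F n in sequentially. \<forall>A. estimates_ST A n (2 ^ ?d) (5/3 - \<epsilon>) p \<longrightarrow>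
          ereal ((2 * p - 1) / 4 ^ 102 * (real n)\<^sup>2 / 4 powr (1/\<epsilon>)) \<le> ereal_of_enat (worst_case_queries A n (2 ^ ?d))"
        using eventually_ge_at_top[of "4 * 2 ^ ?d"]
      proof eventually_elim
        case (elim n)
        show ?case
        proof (intro allI impI)
          fix A assume est: "estimates_ST A n (2 ^ ?d) (5/3 - \<epsilon>) p"
          show "ereal ((2 * p - 1) / 4 ^ 102 * (real n)\<^sup>2 / 4 powr (1/\<epsilon>)) \<le> ereal_of_enat (worst_case_queries A n (2 ^ ?d))"
          proof (cases "worst_case_queries A n (2 ^ ?d)")
            case (enat q)
            have "(2 * p - 1) / 4 ^ 102 * (real n)\<^sup>2 / 4 powr (1/\<epsilon>) = (2 * p - 1) * (real n)\<^sup>2 / (4 ^ 102 * 4 powr (1/\<epsilon>))"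
              by simp
            also have "\<dots> \<le> (2 * p - 1) * (real n)\<^sup>2 / 4 ^ (?d + 1)"
              using pow p by (intro divide_left_mono mult_nonneg_nonneg mult_pos_pos) auto
            also have "\<dots> = (2 * p - 1) * (real n / 2 ^ (?d + 1))\<^sup>2"
            proof -
              have "(2 ^ (?d + 1))\<^sup>2 = (4::real) ^ (?d + 1)"
                unfolding power2_eq_square power_mult_distrib[symmetric] by simp
              then show ?thesis by (simp only: power_divide times_divide_eq_right)
            qed
            also have "\<dots> \<le> q" using bound[OF elim _ _ est enat] \<epsilon> p by auto
            finally show ?thesis by (simp add: enat)
          qed simp
        qed
      qed
    qed
  qed
qed

end
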